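(* Let $\mathbf A \sim \mathcal W_k(n,\mathbf\Sigma)$ with $\operatorname{rank}(\mathbf\Sigma)=r<k$, and let $\mathbf z\sim\mathcal N_k(\boldsymbol\mu,\kappa\mathbf\Sigma)$ with $\kappa>0$, where $\mathbf A$ and $\mathbf z$ are independent. Write $\mathbf\Sigma=\mathbf R\mathbf\Lambda\mathbf R^T$, where $\mathbf\Lambda$ is the $r\times r$ diagonal matrix of the non-zero eigenvalues of $\mathbf\Sigma$ and $\mathbf R$ is the $k\times r$ matrix of corresponding orthonormal eigenvectors. For $\mathbf u\in\mathbb R^k$ and $\zeta>0$ define $$\mathbf\Omega(\zeta)=\kappa^{-1}\mathbf\Lambda^{-1}+\zeta\left[\mathbf\Lambda\cdot\mathbf u^T\mathbf\Sigma\mathbf u-\mathbf\Lambda\mathbf R^T\mathbf u\mathbf u^T\mathbf R\mathbf\Lambda\right],\qquad \boldsymbol\nu=\kappa^{-1}\mathbf\Omega(\zeta)^{-1}\mathbf\Lambda^{-1}\mathbf R^T\boldsymbol\mu$$ (both depending on $\mathbf u$ and $\zeta$). Then the characteristic function $\varphi_{\mathbf A\mathbf z}(\mathbf u)=\mathbb E\exp(i\mathbf u^T\mathbf A\mathbf z)$ is $$\varphi_{\mathbf A\mathbf z}(\mathbf u)=\frac{\exp\left(-\frac{\kappa^{-1}}{2}\boldsymbol\mu^T\mathbf R\mathbf\Lambda^{-1}\mathbf R^T\boldsymbol\mu\right)}{\kappa^{r/2}|\mathbf\Lambda|^{1/2}}\int_0^\infty|\mathbf\Omega(\zeta)|^{-1/2}f_{\chi^2_n}(\zeta)\exp\left(i\zeta\boldsymbol\nu^T\mathbf\Lambda\mathbf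 R^T\mathbf u-\frac{\zeta^2}{2}\mathbf u^T\mathbf R\mathbf\Lambda\mathbf\Omega(\zeta)^{-1}\mathbf\Lambda\mathbf R^T\mathbf u+\frac12\boldsymbol\nu^T\mathbf\Omega(\zeta)\boldsymbol\nu\right)d\zeta,$$ where $f_{\chi^2_n}$ is the density of the $\chi^2_n$ distribution.
   Context: For a $k\times k$ positive semi-definite matrix $\mathbf\Sigma$ (possibly singular) and a positive integer $n$, $\mathbf A\sim\mathcal W_k(n,\mathbf\Sigma)$ means that $\mathbf A \stackrel{d}{=} \mathbf X\mathbf X^T$, where $\mathbf X$ is a $k\times n$ random matrix whose $n$ columns are i.i.d. $\mathcal N_k(\mathbf 0,\mathbf\Sigma)$. $\mathcal N_k(\boldsymbol\mu,\mathbf C)$, for positive semi-definite (possibly singular) $\mathbf C$, is the law of $\boldsymbol\mu+\mathbf C^{1/2}\mathbf g$ with $\mathbf g\sim\mathcal N_k(\mathbf 0,\mathbf I_k)$. $|\cdot|$ denotes the determinant. *)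

theory Defs
  imports "HOL-Probability.Probability"
begin

definition psd :: "real^'k^'k \<Rightarrow> bool" where
  "psd C \<longleftrightarrow> transpose C = C \<and> (\<forall>x. 0 \<le> x \<bullet> (C *v x))"

definition psd_sqrt :: "real^'k^'k \<Rightarrow> real^'k^'k" where
  "psd_sqrt C = (THE S. psd S \<and> S ** S = C)"

definition std_normal_vec :: "(real^'k) measure" where
  "std_normal_vec = density lborel (\<lambda>x. ennreal (\<Prod>i\<in>UNIV. std_normal_density (x $ i)))"

definition mvnormal :: "real^'k \<Rightarrow> real^'k^'k \<Rightarrow> (real^'k) measure" where
  "mvnormal \<mu> C = distr std_normal_vec borel (\<lambda>g. \<mu> + psd_sqrt C *v g)"

definition outer_prod :: "real^'k \<Rightarrow> real^'k \<Rightarrow> real^'k^'k" where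
  "outer_prod v w = (\<chi> i j. v $ i * w $ j)"

text \<open>W_k(n, Sigma): law of X X^T where the n columns x_0..x_(n-1) of X are i.i.d. N_k(0, Sigma);
  X X^T = sum of the outer products x_j x_j^T.\<close>
definition wishart :: "nat \<Rightarrow> real^'k^'k \<Rightarrow> (real^'k^'k) measure" where
  "wishart n \<Sigma> = distr (PiM {..<n} (\<lambda>_. mvnormal 0 \<Sigma>)) borel
     (\<lambda>xs. \<Sum>j<n. outer_prod (xs j) (xs j))"

definition chi2_density :: "nat \<Rightarrow> real \<Rightarrow> real" where
  "chi2_density n x = (if 0 < x then x powr (real n / 2 - 1) * exp (- x / 2)
       / (2 powr (real n / 2) * Gamma (real n / 2)) else 0)"

end

(* Write x_j = S g_j with S = psd_sqrt \<Sigma>, so that u^T A z is the sum of (S u . g_j)(S z . g_j).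
   Rotating S u onto a coordinate axis, the expectation over one g_j for fixed z becomes
   E exp(s X^2) for a scalar standard normal X, where
   s = i u^T \<Sigma> z - ((u^T \<Sigma> u)(z^T \<Sigma> z) - (u^T \<Sigma> z)^2) / 2; its n-th power is E exp(s \<zeta>) with \<zeta> chi-square.
   Interchanging the expectations over \<zeta> and z leaves a Gaussian integral with matrix \<Omega>(\<zeta>).

   Since u^T A z is linear in z, only the characteristic function of z enters, so z may be replaced
   by \<mu> + T y with T = R (\<kappa> \<Lambda>)^(1/2) and y standard normal of dimension r; this avoids comparing
   Gaussian laws in different dimensions.  \<Omega>(\<zeta>) is a diagonal matrix minus one of rank one, hence is
   diagonalized by one scaling and one rotation. *)

theory Submission
  imports Defs
begin

section \<open>Positive semi-definite square roots\<close>

text \<open>The n-th power of \<open>E exp(s X^2)\<close> is never evaluated. In closed form it is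
  \<open>1 - 2 s\<close> to the power \<open>-n/2\<close>, which calls for a branch of a complex
  power. Read as \<open>E exp(s \<zeta>)\<close> it needs only the convolution rule for chi-square
  densities, and the exponent is then quadratic in z, so that the z-integral is Gaussian. The real
  part of s is minus half a Gram determinant, nonpositive by Cauchy-Schwarz. This bounds the
  integrands by 1 for \<zeta> >= 0, which is what the interchanges of integrals rest on. The same
  inequality for the inner product \<open>x . \<Lambda> y\<close> makes the bracket in
  \<Omega>(\<zeta>) positive semi-definite, so \<Omega>(\<zeta>) is positive definite for \<zeta> >=
  0. The linear coefficient of the Gaussian integral is complex. A real shift absorbs its real part
  and the known characteristic function its imaginary part, so no contour is moved.
  \<open>psd_sqrt\<close> is a definite description, so the explicit roots
  \<open>R \<Lambda>^(1/2) R^T\<close> can stand for it only after uniqueness is proved.\<close>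

lemma adjoint_matrix_vector:
  fixes A :: "real^'n^'m"
  shows "x \<bullet> (A *v y) = (transpose A *v x) \<bullet> y"
  by (simp add: dot_lmul_matrix)

lemma outer_prod_mult_vec: "outer_prod a b *v z = (b \<bullet> z) *\<^sub>R a"
  by (simp add: vec_eq_iff outer_prod_def matrix_vector_mult_def inner_vec_def sum_distrib_left mult_ac)

text \<open>Moving \<open>x\<close> by \<open>- t S x\<close> changes the form by
  \<open>t^2 q - 2 t |S x|^2\<close>. For small positive \<open>t\<close> this would be negative
  unless \<open>S x = 0\<close>.\<close>

lemma psd_inner_zero_imp:
  assumes "psd S" "x \<bullet> (S *v x) = 0"
  shows "S *v x = 0"
proof -
  define w where "w = S *v x"
  define q where "q = w \<bullet> (S *v w)"
  have sym: "transpose S = S" and nn: "\<And>x. 0 \<le> x \<bullet> (S *v x)"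
    using assms(1) by (auto simp: psd_def)
  have xw: "x \<bullet> (S *v w) = w \<bullet> w"
    by (metis adjoint_matrix_vector sym w_def)
  have *: "0 \<le> t\<^sup>2 * q - 2 * t * (w \<bullet> w)" for t
  proof -
    have "0 \<le> (x - t *\<^sub>R w) \<bullet> (S *v (x - t *\<^sub>R w))" by (rule nn)
    also have "\<dots> = t\<^sup>2 * q - 2 * t * (w \<bullet> w)"
      using assms(2) xw
      by (simp add: matrix_vector_mult_diff_distrib matrix_vector_mult_scaleR
          inner_diff_left inner_diff_right q_def w_def[symmetric] power2_eq_square algebra_simps)
    finally show ?thesis .
  qed
  have "q \<ge> 0" unfolding q_def by (rule nn)
  have "w \<bullet> w \<le> 0"
  proof (rule ccontr)
    assume "\<not> w \<bullet> w \<le> 0"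
    then have pos: "w \<bullet> w > 0" by linarith
    \<comment> \<open>The minimizer of the quadratic is \<open>(w . w) / q\<close>; adding 1 keeps
      the denominator positive when \<open>q = 0\<close>.\<close>
    define t where "t = (w \<bullet> w) / (q + 1)"
    have t: "t > 0" using pos \<open>q \<ge> 0\<close> by (simp add: t_def)
    have "0 \<le> t * (t * q - 2 * (w \<bullet> w))"
      using *[of t] by (simp add: power2_eq_square algebra_simps)
    then have "2 * (w \<bullet> w) \<le> t * q" using t by (simp add: zero_le_mult_iff)
    also have "t * q \<le> w \<bullet> w"
      using pos \<open>q \<ge> 0\<close> by (simp add: t_def field_simps)
    finally show False using pos by simp
  qed
  moreover have "0 \<le> w \<bullet> w" by simp
  ultimately have "w \<bullet> w = 0" by linarith
  then show ?thesis by (simp add: w_def)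
qed

text \<open>In this form each summand is nonnegative once \<open>S\<close> is positive
  semi-definite, so a vanishing trace forces every summand to vanish.\<close>

lemma trace_quadratic:
  fixes D S :: "real^'n^'n"
  assumes "transpose D = D"
  shows "trace (D ** S ** D) = (\<Sum>i\<in>UNIV. (D *v axis i 1) \<bullet> (S *v (D *v axis i 1)))"
proof -
  have "(D *v axis i 1) \<bullet> (S *v (D *v axis i 1)) = (D ** S ** D) $ i $ i" for i
  proof -
    have "(D *v axis i 1) \<bullet> (S *v (D *v axis i 1)) = axis i 1 \<bullet> ((D ** S ** D) *v axis i 1)"
      using assms by (simp add: adjoint_matrix_vector matrix_vector_mul_assoc[symmetric])
    then show ?thesis
      by (simp add: inner_axis' matrix_vector_mul_component column_def
          matrix_vector_mult_basis del: matrix_vector_mul_assoc)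
  qed
  then show ?thesis by (simp add: trace_def)
qed

text \<open>With \<open>D = S - T\<close> one has \<open>S D = - D T\<close>, so \<open>tr (D S D) + tr (D T D) = 0\<close>
  and both traces vanish.\<close>

lemma psd_square_unique:
  fixes S T :: "real^'n^'n"
  assumes S: "psd S" and T: "psd T" and eq: "S ** S = T ** T"
  shows "S = T"
proof -
  define D where "D = S - T"
  have sym: "transpose D = D"
    using S T by (simp add: psd_def D_def transpose_def vec_eq_iff)
  \<comment> \<open>The mixed products cancel in \<open>S D + D T = S^2 - T^2\<close>, so
    \<open>S\<close> and \<open>T\<close> may fail to commute.\<close>
  have SD: "S ** D = - (D ** T)"
    using eq by (simp add: D_def matrix_matrix_mult_def vec_eq_iff left_diff_distrib right_diff_distrib sum_subtractf)
  have "trace (D ** S ** D) = - trace (D ** T ** D)"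
  proof -
    have "D ** S ** D = - (D ** (D ** T))"
      by (simp add: matrix_mul_assoc[symmetric] SD) (simp add: matrix_matrix_mult_def vec_eq_iff sum_negf)
    moreover have "trace (D ** (D ** T)) = trace (D ** T ** D)" by (rule trace_mul_sym)
    ultimately show ?thesis by (simp add: trace_def sum_negf)
  qed
  then have 0: "(\<Sum>i\<in>UNIV. (D *v axis i 1) \<bullet> (S *v (D *v axis i 1))) +
      (\<Sum>i\<in>UNIV. (D *v axis i 1) \<bullet> (T *v (D *v axis i 1))) = 0"
    by (simp add: trace_quadratic[OF sym])
  have nnS: "0 \<le> x \<bullet> (S *v x)" and nnT: "0 \<le> x \<bullet> (T *v x)" for x
    using S T by (auto simp: psd_def)
  have "D *v axis i 1 = 0" for i
  proof -
    define x where "x = D *v axis i 1"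
    have "(\<Sum>i\<in>UNIV. (D *v axis i 1) \<bullet> (S *v (D *v axis i 1))) = 0"
      "(\<Sum>i\<in>UNIV. (D *v axis i 1) \<bullet> (T *v (D *v axis i 1))) = 0"
      using 0 by (simp_all add: add_nonneg_eq_0_iff sum_nonneg nnS nnT)
    then have "x \<bullet> (S *v x) = 0" "x \<bullet> (T *v x) = 0"
      by (simp_all add: sum_nonneg_eq_0_iff nnS nnT x_def)
    then have "S *v x = 0" "T *v x = 0"
      using S T by (auto intro: psd_inner_zero_imp)
    then have "D *v x = 0"
      by (simp add: D_def matrix_vector_mult_diff_rdistrib)
    \<comment> \<open>Since \<open>D\<close> is symmetric and \<open>x\<close> is the image of the
      i-th axis under \<open>D\<close>, this inner product is \<open>x . x\<close>.\<close>
    then have "axis i 1 \<bullet> (D *v x) = 0" by simp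
    then have "x \<bullet> x = 0" by (simp add: adjoint_matrix_vector sym x_def)
    then show ?thesis by (simp add: x_def)
  qed
  then have "D = 0"
    by (simp add: matrix_vector_mult_basis column_def vec_eq_iff)
  then show ?thesis by (simp add: D_def)
qed

lemma psd_sqrt_eqI:
  assumes "psd S" "S ** S = C"
  shows "psd_sqrt C = S"
  unfolding psd_sqrt_def using assms psd_square_unique by blast

section \<open>The standard normal vector\<close>

lemma vec_nth_measurable [measurable]: "(\<lambda>x::real^'k. x $ i) \<in> borel_measurable borel"
  by (intro borel_measurable_continuous_onI continuous_intros)

lemma vec_lambda_measurable_PiM:
  "(\<lambda>f. \<chi> i. f i) \<in> measurable (PiM UNIV (\<lambda>_. borel :: real measure)) (borel :: (real^'k) measure)"
proof (rule borel_measurable_euclidean_space[THEN iffD2], rule ballI)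
  fix b :: "real^'k" assume "b \<in> Basis"
  then obtain i where "b = axis i 1" by (auto simp: Basis_vec_def)
  then show "(\<lambda>f. (\<chi> i. f i) \<bullet> b) \<in> borel_measurable (PiM UNIV (\<lambda>_. borel))"
    by (simp add: inner_axis)
qed

text \<open>Tonelli over the coordinates. \<open>lborel\<close> on vectors is organized by
  \<open>Basis\<close>, so each basis vector \<open>axis i 1\<close> is traded for its index
  \<open>i\<close>.\<close>

lemma nn_integral_lborel_vec_prod:
  fixes f :: "'k::finite \<Rightarrow> real \<Rightarrow> ennreal"
  assumes [measurable]: "\<And>i. f i \<in> borel_measurable borel"
  shows "(\<integral>\<^sup>+x. (\<Prod>i\<in>UNIV. f i (x $ i)) \<partial>(lborel :: (real^'k) measure)) = (\<Prod>i\<in>UNIV. \<integral>\<^sup>+x. f i x \<partial>lborel)"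
proof -
  define g where "g b = f (axis_index b)" for b :: "real^'k"
  have inj: "inj_on (\<lambda>i::'k. axis i (1::real)) UNIV" by (auto simp: inj_on_def axis_eq_axis)
  have B: "(Basis :: (real^'k) set) = (\<lambda>i. axis i 1) ` UNIV" by (auto simp: Basis_vec_def)
  have "(\<Prod>i\<in>UNIV. f i (x $ i)) = (\<Prod>b\<in>Basis. g b (x \<bullet> b))" for x :: "real^'k"
    unfolding B by (subst prod.reindex[OF inj]) (simp add: g_def inner_axis axis_index_axis)
  moreover have "(\<Prod>b\<in>(Basis :: (real^'k) set). \<integral>\<^sup>+x. g b x \<partial>lborel) = (\<Prod>i\<in>UNIV. \<integral>\<^sup>+x. f i x \<partial>lborel)"
    unfolding B by (subst prod.reindex[OF inj]) (simp add: g_def axis_index_axis)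
  moreover have "(\<integral>\<^sup>+x. (\<Prod>b\<in>(Basis :: (real^'k) set). g b (x \<bullet> b)) \<partial>lborel) = (\<Prod>b\<in>(Basis :: (real^'k) set). \<integral>\<^sup>+x. g b x \<partial>lborel)"
    by (rule nn_integral_lborel_prod) (simp_all add: g_def)
  ultimately show ?thesis by simp
qed

interpretation std_normal: prob_space std_normal_distribution
  by (rule prob_space_normal_density) simp

interpretation std_normal_PiM: product_prob_space "\<lambda>_. std_normal_distribution" I for I :: "'i set"
  by unfold_locales

lemma sets_std_normal_vec [measurable_cong, simp]: "sets std_normal_vec = sets borel"
  by (simp add: std_normal_vec_def)

lemma space_std_normal_vec [simp]: "space std_normal_vec = UNIV"
  by (simp add: std_normal_vec_def)

text \<open>The definition gives a joint density; separating one coordinate from the others needs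
  independent coordinates. The two laws agree on boxes because the density factorizes.\<close>

lemma std_normal_vec_eq_PiM:
  "(std_normal_vec :: (real^'k) measure) =
    distr (PiM UNIV (\<lambda>_. std_normal_distribution)) borel (\<lambda>f. \<chi> i. f i)"
proof -
  let ?N = "\<lambda>_::'k. std_normal_distribution"
  have sets_N: "sets (PiM UNIV ?N) = sets (PiM UNIV (\<lambda>_. borel))"
    by (intro sets_PiM_cong) auto
  have nth: "vec_nth \<in> measurable (std_normal_vec :: (real^'k) measure) (PiM UNIV ?N)"
    unfolding measurable_cong_sets[OF refl sets_N]
    by (rule measurable_PiM_single') (auto simp: space_PiM)
  have "distr std_normal_vec (PiM UNIV ?N) vec_nth = PiM UNIV ?N"
  proof (rule std_normal_PiM.PiM_eqI)
    fix A :: "'k \<Rightarrow> real set" assume "\<And>i. i \<in> UNIV \<Longrightarrow> A i \<in> sets std_normal_distribution"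
    then have A [measurable]: "\<And>i. A i \<in> sets borel" by simp
    have "emeasure (distr std_normal_vec (PiM UNIV ?N) vec_nth) (Pi\<^sub>E UNIV A)
        = emeasure std_normal_vec (vec_nth -` Pi\<^sub>E UNIV A \<inter> UNIV)"
      by (subst emeasure_distr[OF nth]) (auto intro!: sets_PiM_I_finite)
    also have "\<dots> = (\<integral>\<^sup>+x. (\<Prod>i\<in>UNIV. ennreal (std_normal_density (x $ i))) * indicator (vec_nth -` Pi\<^sub>E UNIV A \<inter> UNIV) x \<partial>lborel)"
      unfolding std_normal_vec_def
    proof (subst emeasure_density)
      have "vec_nth -` Pi\<^sub>E UNIV A \<inter> space (std_normal_vec :: (real^'k) measure) \<in> sets std_normal_vec"
        by (rule measurable_sets[OF nth]) (auto intro!: sets_PiM_I_finite)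
      then show "vec_nth -` Pi\<^sub>E UNIV A \<inter> UNIV \<in> sets (lborel :: (real^'k) measure)" by simp
    qed (auto simp: prod_ennreal)
    also have "\<dots> = (\<integral>\<^sup>+x. (\<Prod>i\<in>UNIV. ennreal (std_normal_density (x $ i)) * indicator (A i) (x $ i)) \<partial>(lborel :: (real^'k) measure))"
      by (intro nn_integral_cong) (auto simp: prod.distrib indicator_def PiE_iff)
    also have "\<dots> = (\<Prod>i\<in>UNIV. \<integral>\<^sup>+x. ennreal (std_normal_density x) * indicator (A i) x \<partial>lborel)"
      by (rule nn_integral_lborel_vec_prod) simp
    also have "\<dots> = (\<Prod>i\<in>UNIV. emeasure std_normal_distribution (A i))"
      by (simp add: emeasure_density)
    finally show "emeasure (distr std_normal_vec (PiM UNIV ?N) vec_nth) (Pi\<^sub>E UNIV A) = \<dots>" .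
  qed auto
  then have "distr (PiM UNIV ?N) borel (\<lambda>f. \<chi> i. f i)
      = distr (distr std_normal_vec (PiM UNIV ?N) vec_nth) borel (\<lambda>f. \<chi> i. f i)"
    by simp
  also have "\<dots> = distr std_normal_vec borel (\<lambda>x. x)"
    using vec_lambda_measurable_PiM[where 'k='k]
    by (subst distr_distr) (auto simp: nth measurable_cong_sets[OF sets_N] o_def)
  also have "\<dots> = (std_normal_vec :: (real^'k) measure)" by (intro distr_id2) simp
  finally show ?thesis ..
qed

lemma vec_lambda_measurable_std_normal [measurable]:
  "(\<lambda>f. \<chi> i. f i) \<in> measurable (PiM UNIV (\<lambda>_. std_normal_distribution)) (borel :: (real^'k) measure)"
  using vec_lambda_measurable_PiM[where 'k='k]
  by (subst measurable_cong_sets[OF sets_PiM_cong[of UNIV UNIV _ "\<lambda>_. borel"] refl]) auto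

interpretation std_normal_vec: prob_space "std_normal_vec :: (real^'k) measure"
  unfolding std_normal_vec_eq_PiM
  by (rule std_normal_PiM.prob_space_distr) (rule vec_lambda_measurable_std_normal)

section \<open>Exponential moments of Gaussian vectors with complex exponents\<close>

lemma integral_std_normal_vec_PiM:
  fixes f :: "real^'k \<Rightarrow> complex"
  assumes [measurable]: "f \<in> borel_measurable borel"
  shows "integral\<^sup>L std_normal_vec f = (\<integral>x. f (\<chi> i. x i) \<partial>PiM UNIV (\<lambda>_. std_normal_distribution))"
  unfolding std_normal_vec_eq_PiM by (rule integral_distr) auto

text \<open>The value is \<open>exp ((p + i q)^2 / 2)\<close>. Shifting the variable by the real
  number \<open>p\<close> removes the real part of the exponent, and what remains is the
  characteristic function at \<open>q\<close>.\<close>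

lemma integral_std_normal_exp:
  fixes p q :: real
  shows "integrable std_normal_distribution (\<lambda>x. exp (Complex (p * x) (q * x)))"
    and "(\<integral>x. exp (Complex (p * x) (q * x)) \<partial>std_normal_distribution)
      = exp (Complex ((p\<^sup>2 - q\<^sup>2) / 2) (p * q))"
proof -
  have char: "(\<integral>x. std_normal_density x *\<^sub>R iexp (q * x) \<partial>lborel) = complex_of_real (exp (- q\<^sup>2 / 2))"
    using fun_cong[OF char_std_normal_distribution, of q] unfolding char_def
    by (subst (asm) integral_density) auto
  have intchar: "integrable lborel (\<lambda>x. std_normal_density x *\<^sub>R iexp (q * x))"
  proof -
    have "integrable std_normal_distribution (\<lambda>x. iexp (q * x))"
      by (rule std_normal.integrable_const_bound[of _ 1]) auto
    then show ?thesis by (subst (asm) integrable_density) auto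
  qed
  \<comment> \<open>Completing the square: the shifted density contributes
    \<open>exp (- p x - p^2 / 2)\<close>, which cancels the growth of the exponential and leaves a
    constant.\<close>
  have eq: "std_normal_density (p + x) *\<^sub>R exp (Complex (p * (p + x)) (q * (p + x)))
      = exp (Complex (p\<^sup>2 / 2) (p * q)) * (std_normal_density x *\<^sub>R iexp (q * x))" for x
  proof -
    have 1: "std_normal_density (p + x) = std_normal_density x * exp (- p * x - p\<^sup>2 / 2)"
      by (simp add: std_normal_density_def mult_exp_exp power2_eq_square field_simps)
    have "complex_of_real (exp (- p * x - p\<^sup>2 / 2)) * exp (Complex (p * (p + x)) (q * (p + x)))
        = exp (Complex (p\<^sup>2 / 2) (p * q)) * iexp (q * x)"
      unfolding exp_of_real[symmetric] mult_exp_exp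
      by (intro arg_cong[where f=exp]) (simp add: complex_eq_iff power2_eq_square field_simps)
    then show ?thesis by (simp add: 1 scaleR_conv_of_real)
  qed
  have int1: "integrable lborel (\<lambda>x. std_normal_density (p + x) *\<^sub>R exp (Complex (p * (p + x)) (q * (p + x))))"
    unfolding eq by (intro integrable_mult_right intchar)
  have int2: "integrable lborel (\<lambda>x. std_normal_density x *\<^sub>R exp (Complex (p * x) (q * x)))"
    using lborel_integrable_real_affine[OF int1, of 1 "-p"] by simp
  have meas: "(\<lambda>x. exp (Complex (p * x) (q * x))) \<in> borel_measurable borel"
    unfolding Complex_eq by (intro borel_measurable_continuous_onI continuous_intros)
  show "integrable std_normal_distribution (\<lambda>x. exp (Complex (p * x) (q * x)))"
    using int2 meas by (subst integrable_density) auto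
  have "(\<integral>x. exp (Complex (p * x) (q * x)) \<partial>std_normal_distribution)
      = (\<integral>x. std_normal_density x *\<^sub>R exp (Complex (p * x) (q * x)) \<partial>lborel)"
    using meas by (subst integral_density) auto
  also have "\<dots> = (\<integral>x. std_normal_density (p + x) *\<^sub>R exp (Complex (p * (p + x)) (q * (p + x))) \<partial>lborel)"
    using lborel_integral_real_affine[of 1 "\<lambda>x. std_normal_density x *\<^sub>R exp (Complex (p * x) (q * x))" p] by simp
  also have "\<dots> = exp (Complex (p\<^sup>2 / 2) (p * q)) * complex_of_real (exp (- q\<^sup>2 / 2))"
    unfolding eq by (simp only: integral_mult_right_zero char)
  also have "\<dots> = exp (Complex ((p\<^sup>2 - q\<^sup>2) / 2) (p * q))"
    unfolding exp_of_real[symmetric] mult_exp_exp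
    by (intro arg_cong[where f=exp]) (simp add: complex_eq_iff field_simps)
  finally show "(\<integral>x. exp (Complex (p * x) (q * x)) \<partial>std_normal_distribution)
      = exp (Complex ((p\<^sup>2 - q\<^sup>2) / 2) (p * q))" .
qed

lemma exp_Complex_sum:
  "finite I \<Longrightarrow> exp (Complex (sum f I) (sum g I)) = (\<Prod>i\<in>I. exp (Complex (f i) (g i)))"
  by (subst exp_sum[symmetric], assumption, rule arg_cong[where f=exp]) (simp add: complex_eq_iff)

lemma borel_measurable_exp_Complex [measurable]:
  assumes [measurable]: "f \<in> borel_measurable M" "g \<in> borel_measurable M"
  shows "(\<lambda>x. exp (Complex (f x) (g x))) \<in> borel_measurable M"
proof -
  have [measurable]: "(exp :: complex \<Rightarrow> complex) \<in> borel_measurable borel"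
    by (intro borel_measurable_continuous_onI continuous_intros)
  show ?thesis unfolding Complex_eq by measurable
qed

lemma integral_std_normal_PiM_exp:
  fixes p q :: "'i \<Rightarrow> real"
  assumes "finite I"
  shows "(\<integral>x. exp (Complex (\<Sum>i\<in>I. p i * x i) (\<Sum>i\<in>I. q i * x i)) \<partial>PiM I (\<lambda>_. std_normal_distribution))
    = exp (Complex (\<Sum>i\<in>I. ((p i)\<^sup>2 - (q i)\<^sup>2) / 2) (\<Sum>i\<in>I. p i * q i))"
  unfolding exp_Complex_sum[OF assms]
  by (subst std_normal_PiM.product_integral_prod[OF assms integral_std_normal_exp(1)])
     (simp add: integral_std_normal_exp(2))

lemma inner_vec_measurable [measurable]: "(\<lambda>x::real^'k. p \<bullet> x) \<in> borel_measurable borel"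
  by measurable

text \<open>The exponent is half of \<open>(p + i q) . (p + i q)\<close> in the bilinear sense,
  without conjugation.\<close>

lemma integral_std_normal_vec_exp:
  fixes p q :: "real^'k"
  shows "(\<integral>x. exp (Complex (p \<bullet> x) (q \<bullet> x)) \<partial>std_normal_vec)
    = exp (Complex ((p \<bullet> p - q \<bullet> q) / 2) (p \<bullet> q))"
  using integral_std_normal_PiM_exp[of UNIV "\<lambda>i. p $ i" "\<lambda>i. q $ i"]
  by (subst integral_std_normal_vec_PiM)
     (simp_all add: inner_vec_def power2_eq_square sum_subtractf sum_divide_distrib[symmetric])

lemma integral_std_normal_vec_cis:
  "(\<integral>x. cis (q \<bullet> x) \<partial>(std_normal_vec :: (real^'k) measure)) = complex_of_real (exp (- (q \<bullet> q) / 2))"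
  using integral_std_normal_vec_exp[of 0 q]
  by (simp add: cis_conv_exp Complex_eq exp_of_real[symmetric])

section \<open>Rotations\<close>

text \<open>Disjoint closed balls fill \<open>U\<close> up to a null set, and their preimages are
  disjoint balls of the same radii inside the preimage of \<open>U\<close>. Nothing is known yet
  about the preimage of the null remainder, hence only an inequality.\<close>

lemma emeasure_open_le_isometry_vimage:
  fixes f :: "'a::euclidean_space \<Rightarrow> 'a"
  assumes f: "orthogonal_transformation f" and U: "open U"
  shows "emeasure lborel U \<le> emeasure lborel (f -` U)"
proof -
  define K where "K = {(c, r). 0 < r \<and> cball c r \<subseteq> U}"
  obtain C where C: "countable C" "C \<subseteq> K"
    "pairwise (\<lambda>i j. disjnt (cball (fst i) (snd i)) (cball (fst j) (snd j))) C"
    "negligible (U - (\<Union>i\<in>C. cball (fst i) (snd i)))"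
  proof (rule Vitali_covering_theorem_cballs[of K snd U fst])
    fix x :: 'a and d :: real assume x: "x \<in> U" and d: "0 < d"
    then obtain e where e: "e > 0" "cball x e \<subseteq> U" using U open_contains_cball by blast
    \<comment> \<open>The radius \<open>e\<close> keeps the ball inside \<open>U\<close>;
      \<open>d/2\<close> makes it strictly smaller than \<open>d\<close>, as a fine covering
      requires.\<close>
    have "cball x (min e (d/2)) \<subseteq> cball x e" by auto
    then have "(x, min e (d/2)) \<in> K" using e d by (auto simp: K_def simp del: cball_min_Int)
    then show "\<exists>i. i \<in> K \<and> x \<in> cball (fst i) (snd i) \<and> snd i < d"
      using e d by (intro exI[of _ "(x, min e (d/2))"]) auto
  next
    show "0 < snd i" if "i \<in> K" for i using that by (auto simp: K_def)
  qed
  define B where "B i = cball (fst i) (snd i)" for i :: "'a \<times> real"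
  have cont: "continuous_on UNIV f"
    using orthogonal_transformation_linear[OF f] by (intro linear_continuous_on) (simp add: linear_conv_bounded_linear)
  obtain h where h: "orthogonal_transformation h" "\<And>x. f (h x) = x" "\<And>x. h (f x) = x"
    using f by (metis orthogonal_transformation_bij orthogonal_transformation_inv bij_inv_eq_iff)
  have vB: "f -` B i = cball (h (fst i)) (snd i)" for i
  proof -
    have "dist (fst i) (f y) = dist (h (fst i)) y" for y
      by (metis f h(2) orthogonal_transformation_isometry)
    then show ?thesis by (auto simp: B_def)
  qed
  have eqB: "emeasure lborel (f -` B i) = emeasure lborel (B i)" if "i \<in> C" for i
    using that C(2) by (subst vB) (auto simp: B_def K_def emeasure_cball)
  have Bm: "B i \<in> sets lborel" for i by (simp add: B_def)
  have BU: "(\<Union>i\<in>C. B i) \<subseteq> U" 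
  proof (rule UN_least)
    fix i assume "i \<in> C"
    then have "i \<in> K" using C(2) by blast
    then show "B i \<subseteq> U" by (cases i) (simp add: K_def B_def)
  qed
  have disj: "disjoint_family_on B C"
    using C(3) by (auto simp: disjoint_family_on_def pairwise_def B_def disjnt_def)
  have mUn: "(\<Union>i\<in>C. B i) \<in> sets lborel"
    using C(1) by (auto intro!: sets.countable_UN'' simp: B_def)
  have "U - (\<Union>i\<in>C. B i) \<in> null_sets lborel"
    using C(4) U mUn by (subst null_sets_completion_iff[symmetric]) (auto simp: negligible_iff_null_sets B_def)
  then have "emeasure lborel ((\<Union>i\<in>C. B i) \<union> (U - (\<Union>i\<in>C. B i))) = emeasure lborel (\<Union>i\<in>C. B i)"
    by (intro emeasure_Un_null_set mUn)
  then have "emeasure lborel U = emeasure lborel (\<Union>i\<in>C. B i)"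
    using BU by (simp add: Un_Diff_cancel sup.absorb2)
  also have "\<dots> = (\<integral>\<^sup>+i. emeasure lborel (B i) \<partial>count_space C)"
    using C(1) disj Bm by (intro emeasure_UN_countable) auto
  also have "\<dots> = (\<integral>\<^sup>+i. emeasure lborel (f -` B i) \<partial>count_space C)"
    by (intro nn_integral_cong) (simp add: eqB)
  also have "\<dots> = emeasure lborel (\<Union>i\<in>C. f -` B i)"
  proof (rule emeasure_UN_countable[symmetric])
    show "disjoint_family_on (\<lambda>i. f -` B i) C"
      using disj unfolding disjoint_family_on_def by blast
  qed (use C(1) in \<open>auto simp: vB\<close>)
  also have "\<dots> \<le> emeasure lborel (f -` U)"
    using BU U cont by (intro emeasure_mono) (auto simp: open_vimage)
  finally show ?thesis .
qed

text \<open>The library computes the Lebesgue measure of linear images only for well-ordered index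
  types.  Orthogonal maps preserve balls, so by Vitali covering they do not decrease the measure
  of open sets; the inverse map gives equality.\<close>

lemma lborel_distr_orthogonal:
  fixes f :: "'a::euclidean_space \<Rightarrow> 'a"
  assumes f: "orthogonal_transformation f"
  shows "distr lborel borel f = lborel"
proof (rule lborel_eqI[symmetric])
  have cont: "continuous_on UNIV f"
    using orthogonal_transformation_linear[OF f] by (intro linear_continuous_on) (simp add: linear_conv_bounded_linear)
  then have meas[measurable]: "f \<in> borel_measurable borel" by (rule borel_measurable_continuous_onI)
  obtain h where h: "orthogonal_transformation h" "\<And>x. f (h x) = x" "\<And>x. h (f x) = x"
    using f by (metis orthogonal_transformation_bij orthogonal_transformation_inv bij_inv_eq_iff)
  fix l u :: 'a assume le: "\<And>b. b \<in> Basis \<Longrightarrow> l \<bullet> b \<le> u \<bullet> b"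
  \<comment> \<open>The inequality is applied to the inverse \<open>h\<close> and the open preimage
    of the box; pulling back by \<open>h\<close> returns the box itself.\<close>
  have "emeasure lborel (f -` box l u) \<le> emeasure lborel (h -` (f -` box l u))"
    using h(1) cont by (intro emeasure_open_le_isometry_vimage) (auto simp: open_vimage open_box)
  also have "h -` (f -` box l u) = box l u" using h(2) by auto
  finally have "emeasure lborel (f -` box l u) = emeasure lborel (box l u)"
    using emeasure_open_le_isometry_vimage[OF f open_box] by (metis antisym)
  then show "emeasure (distr lborel borel f) (box l u) = (\<Prod>b\<in>Basis. (u - l) \<bullet> b)"
    using le by (simp add: emeasure_distr emeasure_lborel_box)
qed simp

lemma prod_std_normal_density:
  fixes x :: "real^'k"
  shows "(\<Prod>i\<in>UNIV. std_normal_density (x $ i)) = (1 / sqrt (2 * pi)) ^ CARD('k) * exp (- (x \<bullet> x) / 2)"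
  by (simp add: std_normal_density_def prod.distrib exp_sum[symmetric] inner_vec_def power2_eq_square
      sum_negf sum_divide_distrib power_one_over prod_dividef)

text \<open>The density depends on \<open>x . x\<close> alone, which an orthogonal map preserves
  together with Lebesgue measure.\<close>

lemma std_normal_vec_distr_orthogonal:
  fixes f :: "real^'k \<Rightarrow> real^'k"
  assumes f: "orthogonal_transformation f"
  shows "distr std_normal_vec borel f = std_normal_vec"
proof -
  let ?w = "\<lambda>x::real^'k. ennreal (\<Prod>i\<in>UNIV. std_normal_density (x $ i))"
  have [measurable]: "f \<in> borel_measurable borel"
    using orthogonal_transformation_linear[OF f]
    by (intro borel_measurable_continuous_onI linear_continuous_on) (simp add: linear_conv_bounded_linear)
  have inv: "?w (f x) = ?w x" for x
    using f by (simp add: prod_std_normal_density orthogonal_transformation_def)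
  have "distr std_normal_vec borel f = distr (density lborel (\<lambda>x. ?w (f x))) borel f"
    by (simp add: inv std_normal_vec_def)
  also have "\<dots> = density (distr lborel borel f) ?w"
    by (rule density_distr[symmetric]) auto
  also have "\<dots> = std_normal_vec" by (simp add: lborel_distr_orthogonal[OF f] std_normal_vec_def)
  finally show ?thesis .
qed

text \<open>The factor \<open>norm a\<close> lets the statement cover \<open>a = 0\<close>, where
  any unit vector may play the direction; the users then need no case split.\<close>

lemma exists_orthogonal_matrix_onto_direction:
  fixes a :: "real^'k"
  obtains Q :: "real^'k^'k" where "orthogonal_matrix Q" "transpose Q *v a = norm a *\<^sub>R axis k 1"
proof -
  obtain e where e: "norm e = 1" "a = norm a *\<^sub>R e"
  proof (cases "a = 0")
    case True
    then show ?thesis using that[of "axis k 1"] by (simp add: norm_axis_1)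
  next
    case False
    then show ?thesis using that[of "(1 / norm a) *\<^sub>R a"] by simp
  qed
  obtain Q where Q: "orthogonal_matrix Q" "Q *v axis k 1 = e"
    using orthogonal_matrix_exists_basis[OF e(1)] by blast
  have "transpose Q *v e = (transpose Q ** Q) *v axis k 1"
    using Q(2) by (simp add: matrix_vector_mul_assoc[symmetric])
  also have "\<dots> = axis k 1"
    using Q(1) by (simp add: orthogonal_matrix)
  finally have "transpose Q *v (norm a *\<^sub>R e) = norm a *\<^sub>R axis k 1"
    by (simp add: matrix_vector_mult_scaleR)
  then show ?thesis using that Q(1) e(2) by metis
qed

lemma orthogonal_matrix_transformation:
  "orthogonal_matrix (Q :: real^'k^'k) \<Longrightarrow> orthogonal_transformation ((*v) Q)"
  by (simp add: orthogonal_transformation_matrix)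

text \<open>Given \<open>x $ k\<close>, the other coordinates enter linearly with weights
  \<open>\<alpha> * x $ k * b $ i\<close>. Their characteristic function supplies the real part, a
  multiple of the square of \<open>x $ k\<close>; the term \<open>b $ k * x $ k\<close> supplies the
  imaginary part.\<close>

lemma integral_std_normal_vec_coordinate:
  fixes \<alpha> :: real and b :: "real^'k" and k :: 'k
  shows "(\<integral>x. cis (\<alpha> * x $ k * (b \<bullet> x)) \<partial>std_normal_vec)
    = (\<integral>x. exp (Complex (- \<alpha>\<^sup>2 * (b \<bullet> b - (b $ k)\<^sup>2) / 2 * x\<^sup>2) (\<alpha> * b $ k * x\<^sup>2)) \<partial>std_normal_distribution)"
proof -
  let ?N = "\<lambda>_::'k. std_normal_distribution"
  let ?J = "- {k}"
  define F where "F x = cis (\<alpha> * x k * (\<Sum>i\<in>UNIV. b $ i * x i))" for x :: "'k \<Rightarrow> real"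
  have U: "UNIV = {k} \<union> ?J" by auto
  have sumU: "(\<Sum>i\<in>UNIV. g i) = g k + (\<Sum>i\<in>?J. g i)" for g :: "'k \<Rightarrow> real"
    by (metis Compl_eq_Diff_UNIV UNIV_I finite sum.remove)
  have Fm: "F \<in> borel_measurable (PiM UNIV ?N)"
    unfolding F_def cis_conv_exp by measurable
  have PU: "finite_measure (PiM UNIV ?N)"
    by (intro prob_space.finite_measure prob_space_PiM std_normal.prob_space_axioms)
  have Fint: "integrable (PiM ({k} \<union> ?J) ?N) F"
    unfolding U[symmetric] using Fm by (intro finite_measure.integrable_const_bound[OF PU, of _ 1]) (auto simp: F_def)
  \<comment> \<open>The squared length of the component of \<open>b\<close> orthogonal to the k-th
    axis.\<close>
  define c where "c = (\<Sum>i\<in>?J. (b $ i)\<^sup>2)"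
  have c: "c = b \<bullet> b - (b $ k)\<^sup>2"
    by (simp add: c_def inner_vec_def sumU power2_eq_square)
  have "(\<integral>x. cis (\<alpha> * x $ k * (b \<bullet> x)) \<partial>std_normal_vec) = (\<integral>x. F x \<partial>PiM ({k} \<union> ?J) ?N)"
  proof -
    have "(\<lambda>x::real^'k. cis (\<alpha> * x $ k * (b \<bullet> x))) \<in> borel_measurable borel"
      unfolding cis_conv_exp by measurable
    from integral_std_normal_vec_PiM[OF this] show ?thesis
      unfolding U[symmetric] by (simp add: F_def[abs_def] inner_vec_def)
  qed
  also have "\<dots> = (\<integral>x. (\<integral>y. F (merge {k} ?J (x, y)) \<partial>PiM ?J ?N) \<partial>PiM {k} ?N)"
    by (rule std_normal_PiM.product_integral_fold[OF _ _ _ Fint]) auto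
  also have "\<dots> = (\<integral>x. exp (Complex (- \<alpha>\<^sup>2 * c / 2 * (x k)\<^sup>2) (\<alpha> * b $ k * (x k)\<^sup>2)) \<partial>PiM {k} ?N)"
  proof (rule Bochner_Integration.integral_cong[OF refl])
    fix x :: "'k \<Rightarrow> real"
    \<comment> \<open>The zero real part is spelled as a sum over \<open>?J\<close> so that the
      product moment formula applies with \<open>p = 0\<close>.\<close>
    have "F (merge {k} ?J (x, y)) = exp (Complex 0 (\<alpha> * b $ k * (x k)\<^sup>2))
        * exp (Complex (\<Sum>i\<in>?J. 0 * y i) (\<Sum>i\<in>?J. (\<alpha> * x k * b $ i) * y i))" for y
    proof -
      have "(\<Sum>i\<in>UNIV. b $ i * merge {k} ?J (x, y) i) = b $ k * x k + (\<Sum>i\<in>?J. b $ i * y i)"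
        unfolding sumU by (simp add: merge_def)
      then have "F (merge {k} ?J (x, y)) = exp (\<i> * complex_of_real (\<alpha> * x k * (b $ k * x k + (\<Sum>i\<in>?J. b $ i * y i))))"
        by (simp add: F_def cis_conv_exp merge_def)
      also have "\<dots> = exp (Complex 0 (\<alpha> * b $ k * (x k)\<^sup>2))
        * exp (Complex (\<Sum>i\<in>?J. 0 * y i) (\<Sum>i\<in>?J. (\<alpha> * x k * b $ i) * y i))"
        unfolding mult_exp_exp
        by (intro arg_cong[where f=exp]) (simp add: complex_eq_iff sum_distrib_left power2_eq_square algebra_simps)
      finally show ?thesis .
    qed
    then have "(\<integral>y. F (merge {k} ?J (x, y)) \<partial>PiM ?J ?N) = exp (Complex 0 (\<alpha> * b $ k * (x k)\<^sup>2)) *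
       exp (Complex (\<Sum>i\<in>?J. (0\<^sup>2 - (\<alpha> * x k * b $ i)\<^sup>2) / 2) (\<Sum>i\<in>?J. 0 * (\<alpha> * x k * b $ i)))"
      by (simp only: integral_mult_right_zero integral_std_normal_PiM_exp[OF finite])
    also have "\<dots> = exp (Complex (- \<alpha>\<^sup>2 * c / 2 * (x k)\<^sup>2) (\<alpha> * b $ k * (x k)\<^sup>2))"
      unfolding mult_exp_exp c_def
      by (intro arg_cong[where f=exp])
         (simp add: complex_eq_iff sum_distrib_left sum_distrib_right sum_divide_distrib power_mult_distrib sum_negf mult_ac)
    finally show "(\<integral>y. F (merge {k} ?J (x, y)) \<partial>PiM ?J ?N) = \<dots>" .
  qed
  also have "\<dots> = (\<integral>x. exp (Complex (- \<alpha>\<^sup>2 * c / 2 * x\<^sup>2) (\<alpha> * b $ k * x\<^sup>2)) \<partial>std_normal_distribution)"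
    by (rule std_normal_PiM.product_integral_singleton) simp
  finally show ?thesis unfolding c .
qed

text \<open>Rotating \<open>a\<close> onto an axis reduces this to the coordinate case with
  \<open>\<alpha> = norm a\<close>. There \<open>(norm a)^2 * (b' . b' - (b' $ k)^2)\<close> is the
  Gram determinant of \<open>a\<close> and \<open>b\<close>.\<close>

lemma integral_std_normal_vec_bilinear:
  fixes a b :: "real^'k"
  shows "(\<integral>x. cis ((a \<bullet> x) * (b \<bullet> x)) \<partial>std_normal_vec)
    = (\<integral>x. exp (Complex (- ((a \<bullet> a) * (b \<bullet> b) - (a \<bullet> b)\<^sup>2) / 2) (a \<bullet> b) * x\<^sup>2) \<partial>std_normal_distribution)"
proof -
  \<comment> \<open>Any index serves as the axis; this merely names one.\<close>
  obtain k :: 'k where True by simp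
  obtain Q where Q: "orthogonal_matrix Q" "transpose Q *v a = norm a *\<^sub>R axis k 1"
    using exists_orthogonal_matrix_onto_direction by blast
  define b' where "b' = transpose Q *v b"
  have Qt: "orthogonal_transformation ((*v) (transpose Q))"
    using Q(1) by (intro orthogonal_matrix_transformation) simp
  have bb: "b' \<bullet> b' = b \<bullet> b" and ab: "a \<bullet> b = norm a * b' $ k"
  proof -
    show "b' \<bullet> b' = b \<bullet> b" using Qt by (simp add: b'_def orthogonal_transformation_def)
    have "a \<bullet> b = (transpose Q *v a) \<bullet> (transpose Q *v b)" using Qt by (simp add: orthogonal_transformation_def)
    also have "\<dots> = norm a * b' $ k" unfolding Q(2) b'_def by (simp add: inner_axis' del: transpose_matrix_vector)
    finally show "a \<bullet> b = norm a * b' $ k" .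
  qed
  have norm_b: "norm b' = norm b" using bb by (simp add: norm_eq_sqrt_inner)
  have [measurable]: "((*v) Q) \<in> borel_measurable borel"
    by (intro borel_measurable_continuous_onI matrix_vector_mult_linear_continuous_on)
  have m: "(\<lambda>x. cis ((a \<bullet> x) * (b \<bullet> x))) \<in> borel_measurable borel" unfolding cis_conv_exp by measurable
  have "(\<integral>x. cis ((a \<bullet> x) * (b \<bullet> x)) \<partial>std_normal_vec)
      = (\<integral>x. cis ((a \<bullet> x) * (b \<bullet> x)) \<partial>distr std_normal_vec borel ((*v) Q))"
    using Q(1) by (subst std_normal_vec_distr_orthogonal) (auto intro: orthogonal_matrix_transformation)
  also have "\<dots> = (\<integral>x. cis ((a \<bullet> (Q *v x)) * (b \<bullet> (Q *v x))) \<partial>std_normal_vec)"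
    using m by (subst integral_distr) auto
  also have "\<dots> = (\<integral>x. cis (norm a * x $ k * (b' \<bullet> x)) \<partial>std_normal_vec)"
  proof -
    have adj: "y \<bullet> (Q *v x) = (transpose Q *v y) \<bullet> x" for x y :: "real^'k"
      by (simp add: dot_lmul_matrix)
    show ?thesis
      unfolding adj Q(2) b'_def by (simp add: inner_axis' del: transpose_matrix_vector)
  qed
  also have "\<dots> = (\<integral>x. exp (Complex (- (norm a)\<^sup>2 * (b' \<bullet> b' - (b' $ k)\<^sup>2) / 2 * x\<^sup>2) (norm a * b' $ k * x\<^sup>2)) \<partial>std_normal_distribution)"
    by (rule integral_std_normal_vec_coordinate)
  also have "\<dots> = (\<integral>x. exp (Complex (- ((a \<bullet> a) * (b \<bullet> b) - (a \<bullet> b)\<^sup>2) / 2) (a \<bullet> b) * x\<^sup>2) \<partial>std_normal_distribution)"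
    by (intro Bochner_Integration.integral_cong refl arg_cong[where f=exp])
       (simp add: complex_eq_iff norm_b ab power_mult_distrib dot_square_norm algebra_simps)
  finally show ?thesis .
qed

section \<open>The chi-square distribution\<close>

lemma chi2_density_measurable [measurable]: "chi2_density n \<in> borel_measurable borel"
  unfolding chi2_density_def[abs_def] by measurable

lemma chi2_density_nonneg: "0 \<le> chi2_density n x"
  \<comment> \<open>For \<open>n = 0\<close> the conventions \<open>Gamma 0 = 0\<close> and division
    by zero make the density vanish everywhere.\<close>
  by (cases "n = 0") (auto simp: chi2_density_def Gamma_real_nonneg intro!: divide_nonneg_nonneg mult_nonneg_nonneg)

text \<open>The substitution \<open>y = x t\<close> turns the convolution into a Beta integral. The
  exponentials combine to one independent of \<open>t\<close>, and \<open>Gamma a * Gamma b\<close>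
  cancels against the Beta value, leaving \<open>Gamma (a + b)\<close>.\<close>

lemma chi2_density_convolution:
  assumes "n > 0" "m > 0"
  shows "(\<integral>\<^sup>+y. ennreal (chi2_density n (x - y)) * ennreal (chi2_density m y) \<partial>lborel)
    = ennreal (chi2_density (n + m) x)"
proof (cases "x > 0")
  case False
  then have 0: "ennreal (chi2_density n (x - y)) * ennreal (chi2_density m y) = 0" for y
    by (auto simp: chi2_density_def)
  have "(\<integral>\<^sup>+y. ennreal (chi2_density n (x - y)) * ennreal (chi2_density m y) \<partial>lborel) = 0"
    unfolding 0 by simp
  then show ?thesis using False by (simp add: chi2_density_def)
next
  case True
  define a b where "a = real n / 2" and "b = real m / 2"
  have ab: "a > 0" "b > 0" using assms by (auto simp: a_def b_def)
  have apb: "real (n + m) / 2 = a + b" by (simp add: a_def b_def field_simps)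
  define c where "c = exp (- x / 2) / (2 powr a * Gamma a * (2 powr b * Gamma b))"
  have pos: "Gamma a > 0" "Gamma b > 0" "Gamma (a + b) > 0" using ab by (auto intro: Gamma_real_pos)
  have c: "c > 0" using pos by (simp add: c_def)
  define K where "K = c * x powr (a + b - 1)"
  define h where "h t = t powr (b - 1) * (1 - t) powr (a - 1)" for t :: real
  \<comment> \<open>The leading \<open>x\<close> is the Jacobian of \<open>y = x t\<close>.\<close>
  have eq: "x * (chi2_density n (x - (0 + x * t)) * chi2_density m (0 + x * t)) = K * (h t * indicator {0..1} t)" for t
  proof (cases "0 < t \<and> t < 1")
    case t: True
    have 1: "x - x * t = x * (1 - t)" by (simp add: algebra_simps)
    have 2: "x - x * t > 0" "x * t > 0" using t \<open>x > 0\<close> unfolding 1 by auto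
    have e: "exp (- (x - x * t) / 2) * exp (- (x * t) / 2) = exp (- x / 2)"
      unfolding mult_exp_exp by (simp add: field_simps)
    have p: "x * (x powr (a - 1) * x powr (b - 1)) = x powr (a + b - 1)"
    proof -
      have "x powr (a + b - 1) = x powr (1 + ((a - 1) + (b - 1)))" by (simp add: algebra_simps)
      also have "\<dots> = x * (x powr (a - 1) * x powr (b - 1))"
        using True by (subst powr_add, subst powr_add) simp
      finally show ?thesis ..
    qed
    have "x * (chi2_density n (x - x * t) * chi2_density m (x * t))
       = x * (((x * (1 - t)) powr (a - 1) * exp (- (x - x * t) / 2) / (2 powr a * Gamma a))
            * ((x * t) powr (b - 1) * exp (- (x * t) / 2) / (2 powr b * Gamma b)))"
      using 2 by (simp add: chi2_density_def a_def[symmetric] b_def[symmetric] 1)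
    also have "\<dots> = (x * (x powr (a - 1) * x powr (b - 1))) * ((1 - t) powr (a - 1) * t powr (b - 1))
        * (exp (- (x - x * t) / 2) * exp (- (x * t) / 2)) / (2 powr a * Gamma a * (2 powr b * Gamma b))"
      using t \<open>x > 0\<close> by (simp add: powr_mult)
    also have "\<dots> = K * h t" unfolding e p by (simp add: K_def c_def h_def)
    finally show ?thesis using t by simp
  next
    case False
    then have "\<not> (0 < x - x * t \<and> 0 < x * t)"
      using True by (auto simp: zero_less_mult_iff)
    then have l: "chi2_density n (x - x * t) * chi2_density m (x * t) = 0"
      by (auto simp: chi2_density_def)
    \<comment> \<open>At the endpoints \<open>h\<close> vanishes whatever the exponents are, because
      \<open>0 powr y = 0\<close>.\<close>
    have r: "h t * indicator {0..1} t = 0"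
      using False by (auto simp: h_def indicator_def)
    show ?thesis unfolding r add_0 l by simp
  qed
  have "(\<integral>\<^sup>+y. ennreal (chi2_density n (x - y)) * ennreal (chi2_density m y) \<partial>lborel)
      = (\<integral>\<^sup>+y. ennreal (chi2_density n (x - y) * chi2_density m y) \<partial>lborel)"
    by (simp add: ennreal_mult chi2_density_nonneg)
  also have "\<dots> = ennreal x * (\<integral>\<^sup>+t. ennreal (chi2_density n (x - (0 + x * t)) * chi2_density m (0 + x * t)) \<partial>lborel)"
    using True by (subst nn_integral_real_affine[where c=x and t=0]) auto
  also have "\<dots> = (\<integral>\<^sup>+t. ennreal (x * (chi2_density n (x - (0 + x * t)) * chi2_density m (0 + x * t))) \<partial>lborel)"
    using True by (subst nn_integral_cmult[symmetric]) (auto simp: ennreal_mult chi2_density_nonneg)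
  also have "\<dots> = (\<integral>\<^sup>+t. ennreal K * ennreal (h t * indicator {0..1} t) \<partial>lborel)"
    unfolding eq using c by (intro nn_integral_cong) (simp add: K_def h_def ennreal_mult)
  also have "\<dots> = ennreal K * (\<integral>\<^sup>+t. ennreal (h t * indicator {0..1} t) \<partial>lborel)"
    by (rule nn_integral_cmult) (simp add: h_def)
  also have "(\<integral>\<^sup>+t. ennreal (h t * indicator {0..1} t) \<partial>lborel) = ennreal (Beta b a)"
    using nn_integral_has_integral_lebesgue[OF _ has_integral_Beta_real[OF ab(2,1)]]
    by (simp add: h_def mult_ac)
  also have "ennreal K * ennreal (Beta b a) = ennreal (K * Beta b a)"
    using c pos by (intro ennreal_mult[symmetric]) (simp_all add: K_def Beta_def add.commute)
  also have "K * Beta b a = chi2_density (n + m) x"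
    using True pos unfolding chi2_density_def apb
    by (simp add: K_def c_def Beta_def powr_add[symmetric] field_simps add.commute)
  finally show ?thesis .
qed

text \<open>Comparison of distribution functions: below \<open>t\<close> lie the values with
  \<open>\<bar>x\<bar> \<le> sqrt t\<close>, and by symmetry the positive half counts twice.\<close>

lemma distr_std_normal_square:
  "distr std_normal_distribution borel (\<lambda>x. x\<^sup>2) = density lborel (\<lambda>x. ennreal (chi2_density 1 x))"
proof (rule measure_eqI_generator_eq[where E="range atMost" and \<Omega>=UNIV and A="\<lambda>i. {..real i}"])
  have cdf: "emeasure (distr std_normal_distribution borel (\<lambda>x. x\<^sup>2)) {..t}
      = emeasure (density lborel (\<lambda>x. ennreal (chi2_density 1 x))) {..t}" for t
  proof (cases "t > 0")
    case False
    have "emeasure (distr std_normal_distribution borel (\<lambda>x. x\<^sup>2)) {..t} = emeasure std_normal_distribution {x. x\<^sup>2 \<le> t}"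
      by (subst emeasure_distr) (auto simp: vimage_def)
    also have "{x. x\<^sup>2 \<le> t} \<subseteq> {0}"
      using False by (auto) (metis le_less_trans not_less zero_less_power2)
    then have "emeasure std_normal_distribution {x. x\<^sup>2 \<le> t} \<le> emeasure std_normal_distribution {0}"
      by (intro emeasure_mono) auto
    also have "emeasure std_normal_distribution {0} = 0"
      by (subst emeasure_density) auto
    also have "emeasure (density lborel (\<lambda>x. ennreal (chi2_density 1 x))) {..t} = 0"
      using False by (subst emeasure_density) (auto simp: nn_integral_0_iff_AE chi2_density_def indicator_def)
    ultimately show ?thesis by simp
  next
    case True
    let ?r = "sqrt t"
    have r: "?r > 0" "?r^2 = t" using True by auto
    have f: "std_normal_density x = std_normal_density (- x)" for x by (simp add: std_normal_density_def)
    \<comment> \<open>The Jacobian \<open>2 x\<close> of squaring cancels the factor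
      \<open>1 / x\<close> of the density. At 0 the left side vanishes, which permits the half-open
      interval on the right.\<close>
    have pt: "chi2_density 1 (x\<^sup>2) * (2 * x) * indicator {0..?r} x = 2 * std_normal_density x * indicator {0<..?r} x" for x
    proof (cases "x > 0")
      case x: True
      have 1: "(x\<^sup>2) powr (-1/2) = 1 / x" 
        using x by (simp add: powr_minus powr_half_sqrt field_simps)
      have "chi2_density 1 (x\<^sup>2) = ((x\<^sup>2) powr (-1/2)) * exp (- x\<^sup>2 / 2) / (sqrt 2 * sqrt pi)"
        using x by (simp add: chi2_density_def Gamma_one_half_real powr_half_sqrt)
      also have "\<dots> * (2 * x) = 2 * std_normal_density x"
        unfolding 1 using x by (simp add: std_normal_density_def real_sqrt_mult)
      finally show ?thesis using x by (simp add: indicator_def)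
    next
      case False
      then show ?thesis by (cases "x = 0") (auto simp: chi2_density_def indicator_def)
    qed
    have "emeasure (density lborel (\<lambda>x. ennreal (chi2_density 1 x))) {..t}
        = (\<integral>\<^sup>+x. ennreal (chi2_density 1 x * indicator {0\<^sup>2..?r\<^sup>2} x) \<partial>lborel)"
      unfolding r(2) by (subst emeasure_density) (auto intro!: nn_integral_cong simp: indicator_def chi2_density_def)
    also have "\<dots> = (\<integral>\<^sup>+x. ennreal (chi2_density 1 (x\<^sup>2) * (2 * x) * indicator {0..?r} x) \<partial>lborel)"
      using r(1) by (intro nn_integral_substitution)
        (auto intro!: derivative_eq_intros continuous_intros simp: set_borel_measurable_def)
    also have "\<dots> = (\<integral>\<^sup>+x. 2 * ennreal (std_normal_density x * indicator {0<..?r} x) \<partial>lborel)"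
      unfolding pt by (intro nn_integral_cong) (simp add: ennreal_mult mult.assoc)
    also have "\<dots> = 2 * (\<integral>\<^sup>+x. ennreal (std_normal_density x * indicator {0<..?r} x) \<partial>lborel)"
      by (rule nn_integral_cmult) measurable
    also have "\<dots> = (\<integral>\<^sup>+x. ennreal (std_normal_density x * indicator {0<..?r} x) \<partial>lborel)
        + (\<integral>\<^sup>+x. ennreal (std_normal_density x * indicator {-?r..<0} x) \<partial>lborel)"
    proof -
      have "(\<integral>\<^sup>+x. ennreal (std_normal_density x * indicator {-?r..<0} x) \<partial>lborel)
          = (\<integral>\<^sup>+x. ennreal (std_normal_density x * indicator {0<..?r} x) \<partial>lborel)"
        by (subst nn_integral_real_affine[where c="-1" and t=0])
           (auto intro!: nn_integral_cong simp: indicator_def f[symmetric])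
      then show ?thesis by (simp add: mult_2)
    qed
    also have "\<dots> = (\<integral>\<^sup>+x. ennreal (std_normal_density x * indicator {0<..?r} x)
        + ennreal (std_normal_density x * indicator {-?r..<0} x) \<partial>lborel)"
      by (rule nn_integral_add[symmetric]) auto
    \<comment> \<open>The two half-intervals omit only the point 0, a null set.\<close>
    also have "\<dots> = (\<integral>\<^sup>+x. ennreal (std_normal_density x) * indicator {x. x\<^sup>2 \<le> t} x \<partial>lborel)"
    proof (rule nn_integral_cong_AE)
      have iff: "x\<^sup>2 \<le> t \<longleftrightarrow> - ?r \<le> x \<and> x \<le> ?r" for x
        by (metis abs_le_iff minus_le_iff real_sqrt_abs real_sqrt_le_iff)
      have "ennreal (std_normal_density x * indicator {0<..?r} x)
          + ennreal (std_normal_density x * indicator {-?r..<0} x)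
          = ennreal (std_normal_density x) * indicator {x. x\<^sup>2 \<le> t} x" if "x \<noteq> 0" for x
      proof (cases "x > 0")
        case x: True
        then have "- ?r \<le> x" "\<not> x < 0" using r(1) by linarith+
        then show ?thesis using x by (simp only: indicator_def iff mem_Collect_eq) simp
      next
        case False
        then have x: "x < 0" "x \<le> ?r" using that r(1) by linarith+
        then show ?thesis by (simp only: indicator_def iff mem_Collect_eq) simp
      qed
      then show "AE x in lborel. ennreal (std_normal_density x * indicator {0<..?r} x)
          + ennreal (std_normal_density x * indicator {-?r..<0} x)
          = ennreal (std_normal_density x) * indicator {x. x\<^sup>2 \<le> t} x"
        using AE_lborel_singleton[of "0::real"] by auto
    qed
    also have "\<dots> = emeasure (distr std_normal_distribution borel (\<lambda>x. x\<^sup>2)) {..t}"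
      by (subst emeasure_distr) (auto simp: emeasure_density vimage_def)
    finally show ?thesis ..
  qed
  fix X assume "X \<in> range (atMost :: real \<Rightarrow> _)"
  then show "emeasure (distr std_normal_distribution borel (\<lambda>x. x\<^sup>2)) X
      = emeasure (density lborel (\<lambda>x. ennreal (chi2_density 1 x))) X" using cdf by auto
next
  show "Int_stable (range (atMost :: real \<Rightarrow> _))" by (auto simp: Int_stable_def)
  show "(\<Union>i. {..real i}) = UNIV" using real_arch_simple by auto
  interpret D: prob_space "distr std_normal_distribution borel (\<lambda>x. x\<^sup>2)" by (rule std_normal.prob_space_distr) simp
  show "emeasure (distr std_normal_distribution borel (\<lambda>x. x\<^sup>2)) {..real i} \<noteq> \<infinity>" for i :: nat
    by simp
qed (auto simp: borel_eq_atMost)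

text \<open>Total mass one is inherited from convolving probability measures, starting from the law
  of a squared normal variable; no Gamma integral is computed.\<close>

lemma prob_space_chi2:
  assumes "n > 0"
  shows "prob_space (density lborel (\<lambda>x. ennreal (chi2_density n x)))"
  using assms
proof (induction n rule: nat_induct_non_zero)
  case 1
  show ?case unfolding distr_std_normal_square[symmetric] by (rule std_normal.prob_space_distr) simp
next
  case (Suc n)
  let ?D = "\<lambda>n. density lborel (\<lambda>x. ennreal (chi2_density n x))"
  interpret A: prob_space "?D n" by (rule Suc)
  interpret B: prob_space "?D 1"
    unfolding distr_std_normal_square[symmetric] by (rule std_normal.prob_space_distr) simp
  have "?D n \<star> ?D 1 = ?D (n + 1)"
    by (subst convolution_density) (auto simp: chi2_density_convolution Suc A.finite_measure_axioms B.finite_measure_axioms[unfolded One_nat_def])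
  moreover interpret P: pair_prob_space "?D n" "?D 1" ..
  have "prob_space (?D n \<star> ?D 1)"
    unfolding convolution_def by (rule P.prob_space_distr) simp
  ultimately show ?case by simp
qed

lemma AE_chi2_pos: "AE x in density lborel (\<lambda>x. ennreal (chi2_density n x)). 0 < x"
  by (subst AE_density) (auto simp: chi2_density_def)

text \<open>The exponential turns convolution into a product, so each additional degree of freedom
  contributes one more factor. Leaving the right side as a power of an integral avoids complex
  powers.\<close>

lemma chi2_exp_power:
  fixes s :: complex
  assumes "n > 0" and s: "Re s \<le> 0"
  shows "(\<integral>x. exp (s * x) \<partial>density lborel (\<lambda>x. ennreal (chi2_density n x)))
    = (\<integral>x. exp (s * x\<^sup>2) \<partial>std_normal_distribution) ^ n"
  using \<open>n > 0\<close>
proof (induction n rule: nat_induct_non_zero)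
  case 1
  show ?case unfolding distr_std_normal_square[symmetric] by (subst integral_distr) auto
next
  case (Suc n)
  let ?D = "\<lambda>n. density lborel (\<lambda>x. ennreal (chi2_density n x))"
  interpret A: prob_space "?D n" using Suc by (intro prob_space_chi2)
  interpret B: prob_space "?D 1" by (intro prob_space_chi2) simp
  interpret P: pair_prob_space "?D n" "?D 1" ..
  \<comment> \<open>The exponential may be unbounded on the negative axis, which the chi-square law
    does not charge. The truncation provides the global bound 1 needed for Fubini.\<close>
  define F where "F x = exp (s * of_real x) * indicator {0<..} x" for x :: real
  have F_meas [measurable]: "F \<in> borel_measurable borel" unfolding F_def by measurable
  have bound: "norm (F x) \<le> 1" for x
    using s by (auto simp: F_def norm_exp_eq_Re indicator_def mult_nonpos_nonneg)
  have F: "(\<integral>x. F x \<partial>?D m) = (\<integral>x. exp (s * x) \<partial>?D m)" for m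
    using AE_chi2_pos[of m] by (intro integral_cong_AE) (auto simp: F_def)
  have conv: "?D n \<star> ?D 1 = ?D (Suc n)"
    by (subst convolution_density) (auto simp: chi2_density_convolution Suc A.finite_measure_axioms B.finite_measure_axioms[unfolded One_nat_def])
  have "(\<integral>x. F x \<partial>?D (Suc n)) = (\<integral>z. F (fst z + snd z) \<partial>(?D n \<Otimes>\<^sub>M ?D 1))"
    unfolding conv[symmetric] convolution_def
    by (subst integral_distr) (auto simp: case_prod_beta)
  also have "\<dots> = (\<integral>x. (\<integral>y. F (x + y) \<partial>?D 1) \<partial>?D n)"
    by (subst P.integral_fst'[symmetric], rule P.integrable_const_bound[of _ 1])
       (simp_all add: bound)
  also have "\<dots> = (\<integral>x. F x * (\<integral>y. F y \<partial>?D 1) \<partial>?D n)"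
  proof (rule integral_cong_AE)
    \<comment> \<open>The truncated function is multiplicative only at positive arguments; almost
      every \<open>y\<close> is positive, and \<open>x\<close> is assumed to be.\<close>
    have "(\<integral>y. F (x + y) \<partial>?D 1) = F x * (\<integral>y. F y \<partial>?D 1)" if "x > 0" for x
      unfolding integral_mult_right_zero[symmetric]
      using AE_chi2_pos[of 1] that
      by (intro integral_cong_AE) (auto elim!: eventually_mono simp: F_def exp_add[symmetric] algebra_simps)
    then show "AE x in ?D n. (\<integral>y. F (x + y) \<partial>?D 1) = F x * (\<integral>y. F y \<partial>?D 1)"
      using AE_chi2_pos[of n] by auto
    show "(\<lambda>x. \<integral>y. F (x + y) \<partial>?D 1) \<in> borel_measurable (?D n)"
      by (rule B.borel_measurable_lebesgue_integral) simp
  qed auto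
  also have "\<dots> = (\<integral>x. F x \<partial>?D n) * (\<integral>y. F y \<partial>?D 1)" by simp
  finally have "(\<integral>x. exp (s * x) \<partial>?D (Suc n)) = (\<integral>x. exp (s * x) \<partial>?D n) * (\<integral>x. exp (s * x) \<partial>?D 1)"
    by (simp add: F)
  also have "(\<integral>x. exp (s * x) \<partial>?D 1) = (\<integral>x. exp (s * x\<^sup>2) \<partial>std_normal_distribution)"
    unfolding distr_std_normal_square[symmetric] by (subst integral_distr) auto
  finally show ?case using Suc by simp
qed

section \<open>Gaussian integrals\<close>

lemma matrix_vector_mult_measurable [measurable]:
  "((*v) (A :: real^'n^'m)) \<in> borel_measurable borel"
  by (intro borel_measurable_continuous_onI matrix_vector_mult_linear_continuous_on)

text \<open>Change of variables with Jacobian \<open>d\<close>. Quantifying over all measurable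
  \<open>h\<close> spares integrability conditions at each use, and composition multiplies the
  constants, so the Jacobian of a product of matrices is collected factor by factor.\<close>

definition scales_lborel :: "('a::euclidean_space \<Rightarrow> 'a) \<Rightarrow> real \<Rightarrow> bool" where
  "scales_lborel f d \<longleftrightarrow> f \<in> borel_measurable borel \<and>
     (\<forall>h::'a \<Rightarrow> complex. h \<in> borel_measurable borel \<longrightarrow>
        integral\<^sup>L lborel h = d *\<^sub>R (\<integral>x. h (f x) \<partial>lborel))"

lemma scales_lborelD:
  "scales_lborel f d \<Longrightarrow> h \<in> borel_measurable borel \<Longrightarrow>
    integral\<^sup>L lborel h = d *\<^sub>R (\<integral>x. h (f x) \<partial>lborel)" for h :: "_ \<Rightarrow> complex"
  by (simp add: scales_lborel_def)

lemma scales_lborel_comp: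
  assumes f: "scales_lborel f d" and g: "scales_lborel g e"
  shows "scales_lborel (\<lambda>x. f (g x)) (d * e)"
  unfolding scales_lborel_def
proof safe
  have [measurable]: "f \<in> borel_measurable borel" "g \<in> borel_measurable borel"
    using f g by (auto simp: scales_lborel_def)
  show "(\<lambda>x. f (g x)) \<in> borel_measurable borel" by measurable
  fix h :: "'a \<Rightarrow> complex" assume [measurable]: "h \<in> borel_measurable borel"
  have "integral\<^sup>L lborel h = d *\<^sub>R (\<integral>x. h (f x) \<partial>lborel)" by (rule scales_lborelD[OF f]) simp
  also have "(\<integral>x. h (f x) \<partial>lborel) = e *\<^sub>R (\<integral>x. h (f (g x)) \<partial>lborel)" by (rule scales_lborelD[OF g]) simp
  finally show "integral\<^sup>L lborel h = (d * e) *\<^sub>R (\<integral>x. h (f (g x)) \<partial>lborel)" by simp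
qed

lemma scales_lborel_density:
  assumes f[measurable]: "f \<in> borel_measurable borel" and "0 \<le> d"
    and eq: "lborel = density (distr lborel borel f) (\<lambda>_. ennreal d)"
  shows "scales_lborel f d"
  unfolding scales_lborel_def
proof safe
  fix h :: "'a \<Rightarrow> complex" assume [measurable]: "h \<in> borel_measurable borel"
  show "integral\<^sup>L lborel h = d *\<^sub>R (\<integral>x. h (f x) \<partial>lborel)"
    using \<open>0 \<le> d\<close> by (subst eq) (simp add: integral_density integral_distr)
qed (rule f)

lemma scales_lborel_orthogonal:
  assumes "orthogonal_transformation f"
  shows "scales_lborel f 1"
  using assms orthogonal_transformation_linear[OF assms]
  by (intro scales_lborel_density)
     (simp_all add: lborel_distr_orthogonal density_1 borel_measurable_continuous_onI linear_continuous_on linear_conv_bounded_linear)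

section \<open>Diagonal matrices and diagonal affine maps\<close>

definition diag_matrix :: "('n \<Rightarrow> real) \<Rightarrow> real^'n^'n" where
  "diag_matrix v = (\<chi> i j. if i = j then v i else 0)"

lemma diag_matrix_nth: "diag_matrix v $ i $ j = (if i = j then v i else 0)"
  by (simp add: diag_matrix_def)

lemma diag_matrix_mult_vec [simp]: "(diag_matrix v *v x) $ i = v i * x $ i"
  by (simp add: diag_matrix_def matrix_vector_mult_def if_distrib[of "\<lambda>x. x * _"] cong: if_cong)

lemma transpose_diag_matrix: "transpose (diag_matrix v) = diag_matrix v"
  by (simp add: diag_matrix_def transpose_def vec_eq_iff)

lemma diag_matrix_mult: "diag_matrix v ** diag_matrix w = diag_matrix (\<lambda>i. v i * w i)"
  by (simp add: matrix_eq matrix_vector_mul_assoc[symmetric] vec_eq_iff mult.assoc)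

lemma diag_matrix_one: "diag_matrix (\<lambda>_. 1) = mat 1"
  by (simp add: diag_matrix_def mat_def)

lemma det_diag_matrix: "det (diag_matrix v) = (\<Prod>i\<in>UNIV. v i)"
  by (subst det_diagonal) (auto simp: diag_matrix_def)

text \<open>The translation is included because the Gaussian variable to be substituted is
  \<open>m\<close> plus a diagonal scaling of a standard one.\<close>

lemma scales_lborel_diag_affine:
  fixes v :: "'n::finite \<Rightarrow> real" and m :: "real^'n"
  assumes "\<And>i. v i > 0"
  shows "scales_lborel (\<lambda>x. m + diag_matrix v *v x) (\<Prod>i\<in>UNIV. v i)"
proof (rule scales_lborel_density)
  define c where "c b = v (axis_index b)" for b :: "real^'n"
  have inj: "inj_on (\<lambda>i::'n. axis i (1::real)) UNIV" by (auto simp: inj_on_def axis_eq_axis)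
  have B: "(Basis :: (real^'n) set) = (\<lambda>i. axis i 1) ` UNIV" by (auto simp: Basis_vec_def)
  have 1: "(\<Sum>j\<in>Basis. (c j * (x \<bullet> j)) *\<^sub>R j) = diag_matrix v *v x" for x :: "real^'n"
  proof -
    have "(\<Sum>j\<in>Basis. (c j * (x \<bullet> j)) *\<^sub>R j) = (\<Sum>i\<in>UNIV. (v i * x $ i) *\<^sub>R axis i 1)"
      unfolding B by (subst sum.reindex[OF inj]) (simp add: inner_axis c_def axis_index_axis)
    then show ?thesis by (simp add: vec_eq_iff axis_def if_distrib cong: if_cong)
  qed
  have 2: "(\<Prod>j\<in>(Basis :: (real^'n) set). \<bar>c j\<bar>) = (\<Prod>i\<in>UNIV. v i)"
    unfolding B using assms by (subst prod.reindex[OF inj])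
      (simp add: c_def axis_index_axis abs_of_pos)
  have "c j \<noteq> 0" for j using assms[of "axis_index j"] by (simp add: c_def)
  from lborel_affine_euclidean[of c m, OF this]
  show "lborel = density (distr lborel borel (\<lambda>x. m + diag_matrix v *v x)) (\<lambda>_. ennreal (\<Prod>i\<in>UNIV. v i))"
    unfolding 1 2 .
  show "0 \<le> (\<Prod>i\<in>UNIV. v i)" using assms by (intro prod_nonneg) (auto intro: less_imp_le)
qed measurable

section \<open>Gaussian integrals with a quadratic form\<close>

lemma integral_std_normal_vec_lborel:
  fixes f :: "real^'k \<Rightarrow> complex"
  assumes [measurable]: "f \<in> borel_measurable borel"
  shows "integral\<^sup>L std_normal_vec f
    = (1 / sqrt (2 * pi)) ^ CARD('k) *\<^sub>R (\<integral>x. exp (- (x \<bullet> x) / 2) *\<^sub>R f x \<partial>lborel)"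
proof -
  have "integral\<^sup>L std_normal_vec f = (\<integral>x. (\<Prod>i\<in>UNIV. std_normal_density (x $ i)) *\<^sub>R f x \<partial>lborel)"
    unfolding std_normal_vec_def by (rule integral_density) (auto intro!: prod_nonneg)
  also have "\<dots> = (\<integral>x. ((1 / sqrt (2 * pi)) ^ CARD('k)) *\<^sub>R (exp (- (x \<bullet> x) / 2) *\<^sub>R f x) \<partial>lborel)"
    by (simp only: prod_std_normal_density scaleR_scaleR)
  finally show ?thesis by (simp only: integral_scaleR_right)
qed

text \<open>Substituting \<open>P y\<close> for \<open>y\<close> turns the form of \<open>W\<close>
  into \<open>y . y\<close> and moves \<open>transpose P\<close> onto both linear coefficients; the
  rest is the moment formula for a standard normal vector.\<close>

lemma gaussian_integral_congruence:
  fixes P W :: "real^'r^'r" and c \<theta> :: "real^'r"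
  assumes P: "scales_lborel ((*v) P) d" and PWP: "transpose P ** W ** P = mat 1"
  shows "(\<integral>y. exp (Complex (- (y \<bullet> (W *v y)) / 2 + c \<bullet> y) (\<theta> \<bullet> y)) \<partial>lborel)
    = (d * sqrt (2 * pi) ^ CARD('r)) *\<^sub>R exp (Complex
        (((transpose P *v c) \<bullet> (transpose P *v c) - (transpose P *v \<theta>) \<bullet> (transpose P *v \<theta>)) / 2)
        ((transpose P *v c) \<bullet> (transpose P *v \<theta>)))"
proof -
  let ?c = "transpose P *v c" and ?t = "transpose P *v \<theta>"
  have adj: "x \<bullet> (P *v y) = (transpose P *v x) \<bullet> y" for x y :: "real^'r"
    by (simp add: dot_lmul_matrix)
  have q: "(P *v y) \<bullet> (W *v (P *v y)) = y \<bullet> y" for y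
  proof -
    have "(P *v y) \<bullet> (W *v (P *v y)) = y \<bullet> ((transpose P ** W ** P) *v y)"
      by (metis adj inner_commute matrix_vector_mul_assoc)
    then show ?thesis by (simp add: PWP)
  qed
  have "(\<integral>y. exp (Complex (- (y \<bullet> (W *v y)) / 2 + c \<bullet> y) (\<theta> \<bullet> y)) \<partial>lborel)
      = d *\<^sub>R (\<integral>y. exp (Complex (- (y \<bullet> y) / 2 + ?c \<bullet> y) (?t \<bullet> y)) \<partial>lborel)"
    by (subst scales_lborelD[OF P], measurable) (simp only: q adj)
  also have "(\<lambda>y. exp (Complex (- (y \<bullet> y) / 2 + ?c \<bullet> y) (?t \<bullet> y)))
      = (\<lambda>y. exp (- (y \<bullet> y) / 2) *\<^sub>R exp (Complex (?c \<bullet> y) (?t \<bullet> y)))"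
    by (simp add: fun_eq_iff scaleR_conv_of_real exp_of_real[symmetric] mult_exp_exp del: transpose_matrix_vector)
       (intro allI arg_cong[where f=exp], simp add: complex_eq_iff)
  also have "(\<integral>y. exp (- (y \<bullet> y) / 2) *\<^sub>R exp (Complex (?c \<bullet> y) (?t \<bullet> y)) \<partial>lborel)
      = sqrt (2 * pi) ^ CARD('r) *\<^sub>R (\<integral>y. exp (Complex (?c \<bullet> y) (?t \<bullet> y)) \<partial>std_normal_vec)"
    by (subst integral_std_normal_vec_lborel) (simp_all add: power_mult_distrib[symmetric])
  finally show ?thesis by (simp add: integral_std_normal_vec_exp del: transpose_matrix_vector)
qed

text \<open>Writing the matrix as \<open>D - t t\<^sup>T = D\<^sup>1\<^sup>/\<^sup>2 (I - w w\<^sup>T) D\<^sup>1\<^sup>/\<^sup>2\<close>, a rotation taking an axis to the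
  direction of \<open>w\<close> diagonalizes the middle factor.\<close>

lemma diag_minus_rank_one_congruent_identity:
  fixes \<delta> :: "'r::finite \<Rightarrow> real" and t :: "real^'r"
  defines "W \<equiv> diag_matrix \<delta> - outer_prod t t"
  assumes \<delta>: "\<And>i. \<delta> i > 0" and pd: "\<And>x. x \<noteq> 0 \<Longrightarrow> 0 < x \<bullet> (W *v x)"
  obtains P where "transpose P ** W ** P = mat 1" "scales_lborel ((*v) P) \<bar>det P\<bar>"
proof -
  define \<Delta> where "\<Delta> = diag_matrix (\<lambda>i. 1 / sqrt (\<delta> i))"
  define w where "w = \<Delta> *v t"
  have W: "x \<bullet> (W *v y) = (\<Sum>i\<in>UNIV. \<delta> i * (x $ i * y $ i)) - (t \<bullet> x) * (t \<bullet> y)" for x y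
  proof -
    have "outer_prod t t *v y = (t \<bullet> y) *\<^sub>R t"
      by (rule outer_prod_mult_vec)
    then have "x \<bullet> (W *v y) = x \<bullet> (diag_matrix \<delta> *v y) - (t \<bullet> y) * (x \<bullet> t)"
      by (simp add: W_def matrix_vector_mult_diff_rdistrib inner_diff_right)
    then show ?thesis by (simp add: inner_vec_def mult_ac)
  qed
  have W\<Delta>: "(\<Delta> *v x) \<bullet> (W *v (\<Delta> *v y)) = x \<bullet> y - (w \<bullet> x) * (w \<bullet> y)" for x y
  proof -
    have "\<delta> i * (x $ i / sqrt (\<delta> i) * (y $ i / sqrt (\<delta> i))) = x $ i * y $ i" for i
      using \<delta>[of i] by (simp add: field_simps)
    then have "(\<Sum>i\<in>UNIV. \<delta> i * ((\<Delta> *v x) $ i * (\<Delta> *v y) $ i)) = x \<bullet> y"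
      by (simp add: \<Delta>_def inner_vec_def)
    moreover have "t \<bullet> (\<Delta> *v z) = w \<bullet> z" for z
      by (simp add: w_def \<Delta>_def inner_vec_def mult_ac)
    ultimately show ?thesis by (simp add: W)
  qed
  \<comment> \<open>Positivity at \<open>x = \<Delta> *v w\<close> reads
    \<open>0 < |w|^2 (1 - |w|^2)\<close>.\<close>
  have w1: "(norm w)\<^sup>2 < 1"
  proof (cases "w = 0")
    case False
    moreover have "\<delta> i \<noteq> 0" for i using \<delta>[of i] by simp
    ultimately have "\<Delta> *v w \<noteq> 0" by (auto simp: \<Delta>_def vec_eq_iff)
    from pd[OF this] have "0 < (w \<bullet> w) - (w \<bullet> w) * (w \<bullet> w)" unfolding W\<Delta> .
    then have "0 < (norm w)\<^sup>2 * (1 - (norm w)\<^sup>2)"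
      by (simp add: dot_square_norm algebra_simps)
    then show ?thesis by (simp add: zero_less_mult_iff)
  qed simp
  obtain k :: 'r where True by simp
  obtain Q where Q: "orthogonal_matrix Q" "transpose Q *v w = norm w *\<^sub>R axis k 1"
    using exists_orthogonal_matrix_onto_direction by blast
  have orth: "orthogonal_transformation ((*v) Q)" by (rule orthogonal_matrix_transformation[OF Q(1)])
  \<comment> \<open>\<open>I - w w^T\<close> has eigenvalue \<open>1 - |w|^2\<close> along
    \<open>w\<close> and 1 orthogonally to it. Dividing the rotated axis by the square root
    \<open>s\<close> makes the form the identity.\<close>
  define s where "s = sqrt (1 - (norm w)\<^sup>2)"
  have s: "s > 0" "s * s = 1 - (norm w)\<^sup>2" using w1 by (auto simp: s_def)
  define e where "e i = (if i = k then 1 / s else 1)" for i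
  define E where "E = diag_matrix e"
  have e: "e i > 0" for i using s by (simp add: e_def)
  define P where "P = \<Delta> ** Q ** E"
  have Pv: "P *v x = \<Delta> *v (Q *v (E *v x))" for x
    by (simp add: P_def matrix_vector_mul_assoc matrix_mul_assoc)
  have bil: "(P *v x) \<bullet> (W *v (P *v y)) = x \<bullet> y" for x y
  proof -
    have wQ: "w \<bullet> (Q *v (E *v z)) = norm w * z $ k / s" for z
    proof -
      have "w \<bullet> (Q *v (E *v z)) = (transpose Q *v w) \<bullet> (E *v z)" by (simp add: dot_lmul_matrix)
      then show ?thesis unfolding Q(2) by (simp add: inner_axis' E_def e_def)
    qed
    have sumU: "(\<Sum>i\<in>UNIV. g i) = g k + (\<Sum>i\<in>-{k}. g i)" for g :: "'r \<Rightarrow> real"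
      by (metis Compl_eq_Diff_UNIV UNIV_I finite sum.remove)
    have "(P *v x) \<bullet> (W *v (P *v y)) = (E *v x) \<bullet> (E *v y) - (norm w)\<^sup>2 * (x $ k * y $ k) / (s * s)"
      using orth by (simp add: Pv W\<Delta> wQ orthogonal_transformation_def power2_eq_square)
    also have "\<dots> = x \<bullet> y"
    proof -
      define a where "a = x $ k * y $ k"
      have "a / (s * s) - (norm w)\<^sup>2 * a / (s * s) = (a - (norm w)\<^sup>2 * a) / (s * s)"
        by (rule diff_divide_distrib[symmetric])
      also have "a - (norm w)\<^sup>2 * a = a * (s * s)" unfolding s(2) by (simp add: algebra_simps)
      also have "a * (s * s) / (s * s) = a" using s(1) by simp
      finally have "a / (s * s) - (norm w)\<^sup>2 * a / (s * s) = a" .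
      moreover have "(E *v x) \<bullet> (E *v y) = a / (s * s) + (\<Sum>i\<in>-{k}. x $ i * y $ i)"
        by (simp add: inner_vec_def sumU E_def e_def a_def)
      moreover have "x \<bullet> y = a + (\<Sum>i\<in>-{k}. x $ i * y $ i)"
        by (simp add: inner_vec_def sumU a_def)
      ultimately show ?thesis by (simp add: a_def)
    qed
    finally show ?thesis .
  qed
  have "(transpose P ** W ** P) *v y = y" for y
  proof -
    have "x \<bullet> ((transpose P ** W ** P) *v y) = (P *v x) \<bullet> (W *v (P *v y))" for x
    proof -
      have "a \<bullet> (P *v b) = (transpose P *v a) \<bullet> b" for a b :: "real^'r"
        by (simp add: dot_lmul_matrix)
      then show ?thesis by (metis inner_commute matrix_vector_mul_assoc)
    qed
    then have "x \<bullet> ((transpose P ** W ** P) *v y) = x \<bullet> y" for x by (simp add: bil)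
    then show ?thesis by (rule vector_eq_ldot[THEN iffD1, OF allI])
  qed
  then have "transpose P ** W ** P = mat 1" by (simp add: matrix_eq)
  moreover have "scales_lborel ((*v) P) \<bar>det P\<bar>"
  proof -
    have pos: "1 / sqrt (\<delta> i) > 0" for i using \<delta> by simp
    have "scales_lborel (\<lambda>x. 0 + \<Delta> *v (Q *v (0 + E *v x)))
        ((\<Prod>i\<in>UNIV. 1 / sqrt (\<delta> i)) * (1 * (\<Prod>i\<in>UNIV. e i)))"
      unfolding E_def \<Delta>_def
      by (rule scales_lborel_comp[OF scales_lborel_diag_affine[OF pos]
             scales_lborel_comp[OF scales_lborel_orthogonal[OF orth] scales_lborel_diag_affine[OF e]]])
    moreover have "\<bar>det P\<bar> = (\<Prod>i\<in>UNIV. 1 / sqrt (\<delta> i)) * (1 * (\<Prod>i\<in>UNIV. e i))"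
    proof -
      have "\<bar>det Q\<bar> = 1" using det_orthogonal_matrix[OF Q(1)] by auto
      moreover have "(\<Prod>i\<in>UNIV. 1 / sqrt (\<delta> i)) \<ge> 0" "(\<Prod>i\<in>UNIV. e i) \<ge> 0"
        by (intro prod_nonneg less_imp_le[OF pos] less_imp_le[OF e])+
      ultimately show ?thesis
        unfolding P_def det_mul \<Delta>_def E_def det_diag_matrix abs_mult by simp
    qed
    ultimately show ?thesis by (simp add: Pv[abs_def])
  qed
  ultimately show ?thesis by (rule that)
qed

section \<open>Inverse and determinant from a congruence to the identity\<close>

lemma matrix_inv_eqI:
  fixes A B :: "real^'n^'n"
  assumes "A ** B = mat 1"
  shows "matrix_inv A = B"
proof -
  have "B ** A = mat 1" using assms matrix_left_right_inverse by blast
  then have "invertible A" using assms invertible_def by blast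
  then have "matrix_inv A ** A = mat 1"
    unfolding invertible_def matrix_inv_def by (rule someI2_ex) simp
  then have "matrix_inv A = matrix_inv A ** (A ** B)" "matrix_inv A ** A ** B = B"
    using assms by simp_all
  then show ?thesis by (simp add: matrix_mul_assoc)
qed

text \<open>Translates the auxiliary \<open>P\<close> back into \<open>W\<close>: its Jacobian
  becomes the determinant factor of the final formula. The relation
  \<open>det W * (det P)^2 = 1\<close> makes \<open>det W\<close> positive, so the real power is a
  genuine one.\<close>

lemma congruent_identity_inverse:
  fixes P W :: "real^'n^'n"
  assumes "transpose P ** W ** P = mat 1"
  shows "matrix_inv W = P ** transpose P" and "\<bar>det P\<bar> = det W powr (- 1 / 2)"
proof -
  have "P ** (transpose P ** W) = mat 1"
    using assms matrix_left_right_inverse by blast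
  then have 1: "(P ** transpose P) ** W = mat 1" by (simp add: matrix_mul_assoc)
  then have 2: "W ** (P ** transpose P) = mat 1"
    using matrix_left_right_inverse by blast
  show "matrix_inv W = P ** transpose P" using 2 by (rule matrix_inv_eqI)
  have d: "det W * (det P)\<^sup>2 = 1"
    using arg_cong[OF assms, of det] by (simp add: det_mul power2_eq_square mult_ac)
  then have "det P \<noteq> 0" by auto
  then have W: "det W = 1 / (det P)\<^sup>2" using d by (simp add: field_simps)
  show "\<bar>det P\<bar> = det W powr (- 1 / 2)"
    unfolding W using \<open>det P \<noteq> 0\<close>
    by (simp add: powr_minus powr_half_sqrt real_sqrt_divide powr_divide)
qed

lemma sqrt_prod: "sqrt (\<Prod>i\<in>I. f i) = (\<Prod>i\<in>I. sqrt (f i))"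
  by (induction I rule: infinite_finite_induct) (simp_all add: real_sqrt_mult)

text \<open>\<open>Y\<close> has precision matrix \<open>D\<close>, and the quadratic part of the
  exponent adds \<open>\<zeta> (\<alpha> diag \<beta> - t t^T)\<close>, giving \<open>W\<close>. The
  linear coefficient is \<open>D m + i \<zeta> t\<close>; completing the square yields half of its
  bilinear square under the inverse of \<open>W\<close>.\<close>

lemma gaussian_quadratic_expectation:
  fixes \<beta> :: "'r::finite \<Rightarrow> real" and t m :: "real^'r" and \<kappa> \<zeta> \<alpha> :: real
  defines "W \<equiv> diag_matrix (\<lambda>i. 1 / (\<kappa> * \<beta> i) + \<zeta> * \<alpha> * \<beta> i) - \<zeta> *\<^sub>R outer_prod t t"
  defines "D \<equiv> diag_matrix (\<lambda>i. 1 / (\<kappa> * \<beta> i))"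
  defines "Y \<equiv> \<lambda>y. m + diag_matrix (\<lambda>i. sqrt (\<kappa> * \<beta> i)) *v y"
  assumes \<beta>: "\<And>i. \<beta> i > 0" and "\<kappa> > 0" "\<zeta> \<ge> 0" "\<alpha> \<ge> 0"
    and pd: "\<And>x. x \<noteq> 0 \<Longrightarrow> 0 < x \<bullet> (W *v x)"
  shows "(\<integral>y. exp (Complex (- (\<zeta> / 2) * (\<alpha> * (Y y \<bullet> (diag_matrix \<beta> *v Y y)) - (t \<bullet> Y y)\<^sup>2))
            (\<zeta> * (t \<bullet> Y y))) \<partial>std_normal_vec)
    = complex_of_real (exp (- (m \<bullet> (D *v m)) / 2) / sqrt (\<Prod>i\<in>UNIV. \<kappa> * \<beta> i) * det W powr (- 1 / 2)) *
      exp (Complex (((D *v m) \<bullet> (matrix_inv W *v (D *v m)) - \<zeta>\<^sup>2 * (t \<bullet> (matrix_inv W *v t))) / 2)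
            (\<zeta> * (t \<bullet> (matrix_inv W *v (D *v m)))))"
proof -
  define c where "c = D *v m"
  define F where "F Y = exp (Complex (- (\<zeta> / 2) * (\<alpha> * (Y \<bullet> (diag_matrix \<beta> *v Y)) - (t \<bullet> Y)\<^sup>2)) (\<zeta> * (t \<bullet> Y)))"
    for Y :: "real^'r"
  \<comment> \<open>Up to normalization, the density of \<open>Y\<close> times the integrand.
    Integrating over the values of \<open>Y\<close> rather than over \<open>y\<close> makes
    \<open>W\<close> itself the matrix of the quadratic form.\<close>
  define h where "h Y = exp (- ((Y - m) \<bullet> (D *v (Y - m))) / 2) *\<^sub>R F Y" for Y :: "real^'r"
  define d where "d = (\<Prod>i\<in>UNIV. sqrt (\<kappa> * \<beta> i))"
  have \<kappa>\<beta>: "sqrt (\<kappa> * \<beta> i) > 0" for i using \<beta> \<open>\<kappa> > 0\<close> by simp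
  have d: "d > 0" "d = sqrt (\<Prod>i\<in>UNIV. \<kappa> * \<beta> i)"
    using \<kappa>\<beta> by (auto simp: d_def sqrt_prod intro!: prod_pos)
  have F_meas [measurable]: "F \<in> borel_measurable borel" unfolding F_def by measurable
  have h_meas [measurable]: "h \<in> borel_measurable borel" unfolding h_def by measurable
  have Y_meas [measurable]: "Y \<in> borel_measurable borel" unfolding Y_def by measurable
  \<comment> \<open>\<open>\<zeta>\<close> is split into two square roots to reach the shape
    diagonal minus a rank-one square.\<close>
  have W_eq: "W = diag_matrix (\<lambda>i. 1 / (\<kappa> * \<beta> i) + \<zeta> * \<alpha> * \<beta> i) - outer_prod (sqrt \<zeta> *\<^sub>R t) (sqrt \<zeta> *\<^sub>R t)"
    using \<open>\<zeta> \<ge> 0\<close> by (simp add: W_def outer_prod_def vec_eq_iff algebra_simps)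
  obtain P where P: "transpose P ** W ** P = mat 1" "scales_lborel ((*v) P) \<bar>det P\<bar>"
  proof (rule diag_minus_rank_one_congruent_identity[of "\<lambda>i. 1 / (\<kappa> * \<beta> i) + \<zeta> * \<alpha> * \<beta> i" "sqrt \<zeta> *\<^sub>R t"])
    fix i show "0 < 1 / (\<kappa> * \<beta> i) + \<zeta> * \<alpha> * \<beta> i"
      using \<beta>[of i] \<open>\<kappa> > 0\<close> \<open>\<zeta> \<ge> 0\<close> \<open>\<alpha> \<ge> 0\<close> by (intro add_pos_nonneg) auto
  qed (use pd in \<open>auto simp: W_eq\<close>)
  note Wi = congruent_identity_inverse[OF P(1)]
  have PP: "(transpose P *v x) \<bullet> (transpose P *v y) = x \<bullet> (matrix_inv W *v y)" for x y
    unfolding Wi(1) by (simp add: matrix_vector_mul_assoc[symmetric] dot_lmul_matrix)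
  have hY: "h (Y y) = exp (- (y \<bullet> y) / 2) *\<^sub>R F (Y y)" for y
  proof -
    have "(1 / (\<kappa> * \<beta> i)) * (sqrt (\<kappa> * \<beta> i) * y $ i) * (sqrt (\<kappa> * \<beta> i) * y $ i) = y $ i * y $ i" for i
    proof -
      have "sqrt (\<kappa> * \<beta> i) * sqrt (\<kappa> * \<beta> i) = \<kappa> * \<beta> i" "\<kappa> * \<beta> i \<noteq> 0"
        using \<beta>[of i] \<open>\<kappa> > 0\<close> by auto
      then show ?thesis by (simp add: field_simps)
    qed
    then have "(Y y - m) \<bullet> (D *v (Y y - m)) = y \<bullet> y"
      by (simp add: Y_def D_def inner_vec_def mult_ac)
    then show ?thesis by (simp add: h_def)
  qed
  have "(\<integral>y. F (Y y) \<partial>std_normal_vec) = (1 / sqrt (2 * pi)) ^ CARD('r) *\<^sub>R (\<integral>y. h (Y y) \<partial>lborel)"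
    unfolding hY by (rule integral_std_normal_vec_lborel) measurable
  also have "\<dots> = (1 / sqrt (2 * pi)) ^ CARD('r) *\<^sub>R (1 / d) *\<^sub>R integral\<^sup>L lborel h"
    using scales_lborelD[OF scales_lborel_diag_affine[of "\<lambda>i. sqrt (\<kappa> * \<beta> i)" m, OF \<kappa>\<beta>] h_meas] d(1)
    by (simp add: Y_def d_def[symmetric])
  finally have step: "(\<integral>y. F (Y y) \<partial>std_normal_vec)
      = (1 / sqrt (2 * pi)) ^ CARD('r) *\<^sub>R (1 / d) *\<^sub>R integral\<^sup>L lborel h" .
  have h: "h = (\<lambda>y. exp (- (m \<bullet> c) / 2) *\<^sub>R exp (Complex (- (y \<bullet> (W *v y)) / 2 + c \<bullet> y) ((\<zeta> *\<^sub>R t) \<bullet> y)))"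
  proof
    fix y :: "real^'r"
    have W: "y \<bullet> (W *v y) = y \<bullet> (D *v y) + \<zeta> * \<alpha> * (y \<bullet> (diag_matrix \<beta> *v y)) - \<zeta> * (t \<bullet> y)\<^sup>2"
    proof -
      have "outer_prod t t *v y = (t \<bullet> y) *\<^sub>R t"
        by (rule outer_prod_mult_vec)
      then have "W *v y = diag_matrix (\<lambda>i. 1 / (\<kappa> * \<beta> i) + \<zeta> * \<alpha> * \<beta> i) *v y - (\<zeta> * (t \<bullet> y)) *\<^sub>R t"
        by (simp add: W_def matrix_vector_mult_diff_rdistrib scaleR_matrix_vector_assoc[symmetric])
      moreover have "diag_matrix (\<lambda>i. 1 / (\<kappa> * \<beta> i) + \<zeta> * \<alpha> * \<beta> i) *v y = D *v y + (\<zeta> * \<alpha>) *\<^sub>R (diag_matrix \<beta> *v y)"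
        by (simp add: D_def vec_eq_iff algebra_simps)
      ultimately show ?thesis
        by (simp add: inner_diff_right inner_add_right power2_eq_square inner_commute)
    qed
    have Dsym: "m \<bullet> (D *v y) = c \<bullet> y" "y \<bullet> (D *v m) = c \<bullet> y"
      by (simp_all add: c_def D_def inner_vec_def mult_ac)
    have D: "(y - m) \<bullet> (D *v (y - m)) = y \<bullet> (D *v y) - 2 * (c \<bullet> y) + m \<bullet> c"
      by (simp add: matrix_vector_mult_diff_distrib inner_diff_left inner_diff_right Dsym c_def[symmetric] inner_commute[of y c] del: diag_matrix_mult_vec)
    show "h y = exp (- (m \<bullet> c) / 2) *\<^sub>R exp (Complex (- (y \<bullet> (W *v y)) / 2 + c \<bullet> y) ((\<zeta> *\<^sub>R t) \<bullet> y))"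
      unfolding h_def F_def D W inner_scaleR_left
      unfolding scaleR_conv_of_real exp_of_real[symmetric] mult_exp_exp
      by (intro arg_cong[where f=exp]) (simp add: complex_eq_iff, simp add: field_simps)
  qed
  have tt: "(\<zeta> *\<^sub>R t) \<bullet> (matrix_inv W *v (\<zeta> *\<^sub>R t)) = \<zeta>\<^sup>2 * (t \<bullet> (matrix_inv W *v t))"
    by (simp add: matrix_vector_mult_scaleR power2_eq_square)
  have ct: "c \<bullet> (matrix_inv W *v (\<zeta> *\<^sub>R t)) = \<zeta> * (t \<bullet> (matrix_inv W *v c))"
    unfolding PP[symmetric] by (simp add: matrix_vector_mult_scaleR inner_commute del: transpose_matrix_vector)
  have "integral\<^sup>L lborel h = exp (- (m \<bullet> c) / 2) *\<^sub>R (\<bar>det P\<bar> * sqrt (2 * pi) ^ CARD('r)) *\<^sub>R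
        exp (Complex ((c \<bullet> (matrix_inv W *v c) - \<zeta>\<^sup>2 * (t \<bullet> (matrix_inv W *v t))) / 2)
          (\<zeta> * (t \<bullet> (matrix_inv W *v c))))"
    by (simp only: h integral_scaleR_right gaussian_integral_congruence[OF P(2,1)] PP tt ct)
  then have "(\<integral>y. F (Y y) \<partial>std_normal_vec)
      = (exp (- (m \<bullet> c) / 2) / d * \<bar>det P\<bar>) *\<^sub>R
        exp (Complex ((c \<bullet> (matrix_inv W *v c) - \<zeta>\<^sup>2 * (t \<bullet> (matrix_inv W *v t))) / 2)
          (\<zeta> * (t \<bullet> (matrix_inv W *v c))))"
    unfolding step by (simp add: power_divide)
  then show ?thesis
    unfolding F_def Wi(2) c_def[symmetric] d(2)[symmetric] scaleR_conv_of_real .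
qed

section \<open>Wishart matrices and normal vectors\<close>

lemma cis_sum: "finite I \<Longrightarrow> cis (\<Sum>i\<in>I. f i) = (\<Prod>i\<in>I. cis (f i))"
  by (induction I rule: finite_induct) (simp_all add: cis_mult[symmetric])

lemma borel_measurable_cis [measurable]:
  assumes [measurable]: "f \<in> borel_measurable M"
  shows "(\<lambda>x. cis (f x)) \<in> borel_measurable M"
  unfolding cis_conv_exp by measurable

lemma prob_space_mvnormal: "prob_space (mvnormal \<mu> C)"
  unfolding mvnormal_def by (rule std_normal_vec.prob_space_distr) measurable

lemma sets_mvnormal [simp, measurable_cong]: "sets (mvnormal \<mu> C) = sets borel"
  by (simp add: mvnormal_def)

lemma integral_mvnormal:
  fixes f :: "real^'k \<Rightarrow> complex"
  assumes [measurable]: "f \<in> borel_measurable borel"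
  shows "integral\<^sup>L (mvnormal \<mu> C) f = (\<integral>g. f (\<mu> + psd_sqrt C *v g) \<partial>std_normal_vec)"
  unfolding mvnormal_def by (rule integral_distr) measurable

text \<open>The factor \<open>T\<close> may be rectangular, so \<open>mvnormal \<mu> C\<close> can be traded for a standard
  normal vector of dimension \<open>rank C\<close>.\<close>

lemma integral_std_normal_vec_affine_cis:
  fixes T :: "real^'r^'k"
  shows "(\<integral>g. cis (v \<bullet> (\<mu> + T *v g)) \<partial>std_normal_vec)
    = cis (v \<bullet> \<mu>) * exp (- (v \<bullet> ((T ** transpose T) *v v)) / 2)"
proof -
  have "cis (v \<bullet> (\<mu> + T *v g)) = cis (v \<bullet> \<mu>) * cis ((transpose T *v v) \<bullet> g)" for g
    unfolding inner_add_right adjoint_matrix_vector cis_mult ..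
  moreover have "(transpose T *v v) \<bullet> (transpose T *v v) = v \<bullet> ((T ** transpose T) *v v)"
    by (simp add: matrix_vector_mul_assoc[symmetric] dot_lmul_matrix del: matrix_vector_mul_assoc)
  ultimately show ?thesis by (simp add: integral_std_normal_vec_cis)
qed

text \<open>A characteristic function of this kind sees a factor only through its product with its
  transpose, and the symmetric root \<open>S\<close> and the rectangular \<open>T\<close> give the
  same product \<open>C\<close>.\<close>

lemma integral_mvnormal_cis:
  fixes T :: "real^'r^'k"
  assumes S: "psd S" "S ** S = C" and T: "T ** transpose T = C"
  shows "(\<integral>z. cis (v \<bullet> z) \<partial>mvnormal \<mu> C) = (\<integral>g. cis (v \<bullet> (\<mu> + T *v g)) \<partial>std_normal_vec)"
proof -
  have "transpose S = S" using S by (simp add: psd_def)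
  then show ?thesis
    using S T by (subst integral_mvnormal) (simp_all add: integral_std_normal_vec_affine_cis psd_sqrt_eqI[OF S])
qed

section \<open>The Wishart law and its product with an independent normal vector\<close>

lemma outer_prod_self_measurable [measurable]: "(\<lambda>x :: real^'k. outer_prod x x) \<in> borel_measurable borel"
  unfolding outer_prod_def by (intro borel_measurable_continuous_onI continuous_intros)

lemma wishart_map_measurable [measurable]:
  "(\<lambda>xs. \<Sum>j<n. outer_prod (xs j) (xs j)) \<in> borel_measurable (PiM {..<n} (\<lambda>_. mvnormal \<mu> C))"
proof (rule borel_measurable_sum)
  fix j assume "j \<in> {..<n}"
  then have "(\<lambda>xs. xs j) \<in> measurable (PiM {..<n} (\<lambda>_. mvnormal \<mu> C)) borel"
    using measurable_component_singleton[of j "{..<n}" "\<lambda>_. mvnormal \<mu> C"]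
    by (simp add: measurable_cong_sets[OF refl sets_mvnormal])
  from measurable_compose[OF this outer_prod_self_measurable]
  show "(\<lambda>xs. outer_prod (xs j) (xs j)) \<in> borel_measurable (PiM {..<n} (\<lambda>_. mvnormal \<mu> C))" .
qed

lemma prob_space_wishart: "prob_space (wishart n C)"
  unfolding wishart_def
  by (intro prob_space.prob_space_distr prob_space_PiM prob_space_mvnormal wishart_map_measurable)

lemma sets_wishart [simp, measurable_cong]: "sets (wishart n C) = sets borel"
  by (simp add: wishart_def)

lemma bilinear_form_measurable [measurable]:
  "(\<lambda>p. u \<bullet> (fst p *v snd p)) \<in> borel_measurable (borel \<Otimes>\<^sub>M borel :: ((real^'k^'m) \<times> (real^'k)) measure)"
proof -
  have [measurable]: "(\<lambda>A :: real^'k^'m. A $ i $ j) \<in> borel_measurable borel" for i j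
    by (intro borel_measurable_continuous_onI continuous_intros)
  show ?thesis unfolding inner_vec_def matrix_vector_mult_def by simp
qed

lemma integral_wishart_cis:
  fixes C :: "real^'k^'k"
  assumes n: "n > 0" and S: "psd S" "S ** S = C"
  shows "(\<integral>A. cis (u \<bullet> (A *v z)) \<partial>wishart n C)
    = (\<integral>\<zeta>. exp (Complex (- ((u \<bullet> (C *v u)) * (z \<bullet> (C *v z)) - (u \<bullet> (C *v z))\<^sup>2) / 2) (u \<bullet> (C *v z)) * \<zeta>)
        \<partial>density lborel (\<lambda>x. ennreal (chi2_density n x)))"
proof -
  interpret N: prob_space "mvnormal 0 C" by (rule prob_space_mvnormal)
  interpret PN: product_prob_space "\<lambda>_. mvnormal 0 C" "{..<n}" ..
  have sym: "transpose S = S" using S by (simp add: psd_def)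
  have [measurable]: "(\<lambda>A::real^'k^'k. u \<bullet> (A *v z)) \<in> borel_measurable borel"
    using measurable_compose[OF measurable_Pair2'[of z borel borel] bilinear_form_measurable[of u]] by simp
  define a b where "a = S *v u" and "b = S *v z"
  \<comment> \<open>The root enters only through these inner products, so it disappears from the
    final formula.\<close>
  have SS: "(S *v x) \<bullet> (S *v y) = x \<bullet> (C *v y)" for x y
    using sym S(2) adjoint_matrix_vector[of x S "S *v y"] by (metis matrix_vector_mul_assoc)
  let ?s = "Complex (- ((a \<bullet> a) * (b \<bullet> b) - (a \<bullet> b)\<^sup>2) / 2) (a \<bullet> b)"
  have "(\<integral>A. cis (u \<bullet> (A *v z)) \<partial>wishart n C)
      = (\<integral>xs. cis (u \<bullet> ((\<Sum>j<n. outer_prod (xs j) (xs j)) *v z)) \<partial>PiM {..<n} (\<lambda>_. mvnormal 0 C))"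
    unfolding wishart_def by (rule integral_distr) measurable
  also have "\<dots> = (\<integral>xs. (\<Prod>j<n. cis ((u \<bullet> xs j) * (z \<bullet> xs j))) \<partial>PiM {..<n} (\<lambda>_. mvnormal 0 C))"
  proof -
    have "(\<Sum>j<n. outer_prod (xs j) (xs j)) *v z = (\<Sum>j<n. (xs j \<bullet> z) *\<^sub>R xs j)" for xs :: "nat \<Rightarrow> real^'k"
      by (induction n) (simp_all add: matrix_vector_mult_add_rdistrib outer_prod_mult_vec)
    then have "cis (u \<bullet> ((\<Sum>j<n. outer_prod (xs j) (xs j)) *v z)) = (\<Prod>j<n. cis ((u \<bullet> xs j) * (z \<bullet> xs j)))"
      for xs :: "nat \<Rightarrow> real^'k"
      by (simp add: inner_sum_right cis_sum[symmetric] inner_commute mult.commute)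
    then show ?thesis by simp
  qed
  also have "\<dots> = (\<Prod>j<n. \<integral>x. cis ((u \<bullet> x) * (z \<bullet> x)) \<partial>mvnormal 0 C)"
    by (rule PN.product_integral_prod) (auto intro!: N.integrable_const_bound[of _ 1])
  also have "\<dots> = (\<integral>g. cis ((a \<bullet> g) * (b \<bullet> g)) \<partial>std_normal_vec) ^ n"
    by (subst integral_mvnormal)
       (simp_all add: psd_sqrt_eqI[OF S] adjoint_matrix_vector sym a_def b_def del: transpose_matrix_vector)
  also have "\<dots> = (\<integral>x. exp (?s * x\<^sup>2) \<partial>std_normal_distribution) ^ n"
    by (simp only: integral_std_normal_vec_bilinear)
  also have "\<dots> = (\<integral>\<zeta>. exp (?s * \<zeta>) \<partial>density lborel (\<lambda>x. ennreal (chi2_density n x)))"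
    \<comment> \<open>Cauchy-Schwarz gives the nonpositive real part that the chi-square transform
      requires.\<close>
    using Cauchy_Schwarz_ineq[of a b] by (intro chi2_exp_power[OF n, symmetric]) simp
  finally show ?thesis unfolding a_def b_def SS .
qed

text \<open>The absolute value of \<zeta> changes nothing on the positive axis, where the chi-square
  law lives, but bounds the exponential by 1 on the whole product space, as Fubini requires.\<close>

lemma integral_wishart_mvnormal_cis:
  fixes T :: "real^'r^'k" and u \<mu> :: "real^'k"
  assumes n: "n > 0" and S: "psd S" "S ** S = C" and S': "psd S'" "S' ** S' = C'"
    and T: "T ** transpose T = C'"
  defines "z \<equiv> \<lambda>g. \<mu> + T *v g"
  shows "(\<integral>p. cis (u \<bullet> (fst p *v snd p)) \<partial>(wishart n C \<Otimes>\<^sub>M mvnormal \<mu> C'))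
    = (\<integral>\<zeta>. chi2_density n \<zeta> *\<^sub>R
        (\<integral>g. exp (Complex (- ((u \<bullet> (C *v u)) * (z g \<bullet> (C *v z g)) - (u \<bullet> (C *v z g))\<^sup>2) / 2)
          (u \<bullet> (C *v z g)) * complex_of_real \<bar>\<zeta>\<bar>) \<partial>std_normal_vec) \<partial>lborel)"
proof -
  let ?chi = "density lborel (\<lambda>x. ennreal (chi2_density n x))"
  define s where "s g = Complex (- ((u \<bullet> (C *v u)) * (z g \<bullet> (C *v z g)) - (u \<bullet> (C *v z g))\<^sup>2) / 2) (u \<bullet> (C *v z g))" for g
  interpret W: prob_space "wishart n C" by (rule prob_space_wishart)
  interpret N: prob_space "mvnormal \<mu> C'" by (rule prob_space_mvnormal)
  interpret X: prob_space ?chi by (rule prob_space_chi2[OF n])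
  interpret WN: pair_prob_space "wishart n C" "mvnormal \<mu> C'" ..
  interpret WG: pair_prob_space "wishart n C" "std_normal_vec :: (real^'r) measure" ..
  interpret GX: pair_prob_space "std_normal_vec :: (real^'r) measure" ?chi ..
  have z_meas [measurable]: "z \<in> borel_measurable borel" unfolding z_def by measurable
  have s_meas [measurable]: "s \<in> borel_measurable borel" unfolding s_def Complex_eq by measurable
  have "(\<integral>p. cis (u \<bullet> (fst p *v snd p)) \<partial>(wishart n C \<Otimes>\<^sub>M mvnormal \<mu> C'))
      = (\<integral>A. (\<integral>x. cis (u \<bullet> (A *v x)) \<partial>mvnormal \<mu> C') \<partial>wishart n C)"
    by (subst WN.integral_fst'[symmetric], rule WN.integrable_const_bound[of _ 1]) simp_all
  \<comment> \<open>For fixed \<open>A\<close> the inner integral is the characteristic function of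
    the normal vector at \<open>transpose A *v u\<close>, so its law may be represented by
    \<open>T\<close>.\<close>
  also have "\<dots> = (\<integral>A. (\<integral>g. cis (u \<bullet> (A *v z g)) \<partial>std_normal_vec) \<partial>wishart n C)"
    unfolding z_def adjoint_matrix_vector[of u] integral_mvnormal_cis[OF S' T] ..
  \<comment> \<open>Now the normal vector is held fixed, as the Wishart formula demands.\<close>
  also have "\<dots> = (\<integral>g. (\<integral>A. cis (u \<bullet> (A *v z g)) \<partial>wishart n C) \<partial>std_normal_vec)"
  proof (rule WG.Fubini_integral[symmetric])
    have "(\<lambda>p. (fst p, z (snd p))) \<in> measurable (wishart n C \<Otimes>\<^sub>M std_normal_vec) (borel \<Otimes>\<^sub>M borel)" by measurable
    from measurable_compose[OF this bilinear_form_measurable[of u]]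
    have "(\<lambda>p. u \<bullet> (fst p *v z (snd p))) \<in> borel_measurable (wishart n C \<Otimes>\<^sub>M std_normal_vec)" by simp
    then have "(\<lambda>p. cis (u \<bullet> (fst p *v z (snd p)))) \<in> borel_measurable (wishart n C \<Otimes>\<^sub>M std_normal_vec)"
      by measurable
    then show "integrable (wishart n C \<Otimes>\<^sub>M std_normal_vec) (\<lambda>(A, g). cis (u \<bullet> (A *v z g)))"
      unfolding case_prod_beta by (intro WG.integrable_const_bound[of _ 1]) simp_all
  qed
  also have "\<dots> = (\<integral>g. (\<integral>\<zeta>. exp (s g * \<zeta>) \<partial>?chi) \<partial>std_normal_vec)"
    unfolding integral_wishart_cis[OF n S] s_def ..
  also have "\<dots> = (\<integral>g. (\<integral>\<zeta>. exp (s g * complex_of_real \<bar>\<zeta>\<bar>) \<partial>?chi) \<partial>std_normal_vec)"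
  proof (rule Bochner_Integration.integral_cong[OF refl])
    fix g
    show "(\<integral>\<zeta>. exp (s g * \<zeta>) \<partial>?chi) = (\<integral>\<zeta>. exp (s g * complex_of_real \<bar>\<zeta>\<bar>) \<partial>?chi)"
      using AE_chi2_pos[of n] by (intro integral_cong_AE) (auto elim!: eventually_mono)
  qed
  also have "\<dots> = (\<integral>\<zeta>. (\<integral>g. exp (s g * complex_of_real \<bar>\<zeta>\<bar>) \<partial>std_normal_vec) \<partial>?chi)"
  proof (rule GX.Fubini_integral[symmetric])
    have "Re (s g) \<le> 0" for g
    proof -
      have "transpose S = S" using S by (simp add: psd_def)
      then have SS: "(S *v x) \<bullet> (S *v y) = x \<bullet> (C *v y)" for x y
        using S(2) adjoint_matrix_vector[of x S "S *v y"] by (metis matrix_vector_mul_assoc)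
      show ?thesis
        using Cauchy_Schwarz_ineq[of "S *v u" "S *v z g"] by (simp add: SS s_def)
    qed
    then have "norm (exp (s g * complex_of_real \<bar>\<zeta>\<bar>)) \<le> 1" for g \<zeta>
      by (simp add: norm_exp_eq_Re mult_nonpos_nonneg)
    then show "integrable (std_normal_vec \<Otimes>\<^sub>M ?chi) (\<lambda>(g, \<zeta>). exp (s g * complex_of_real \<bar>\<zeta>\<bar>))"
      unfolding case_prod_beta by (intro GX.integrable_const_bound[of _ 1]) simp_all
  qed
  also have "\<dots> = (\<integral>\<zeta>. chi2_density n \<zeta> *\<^sub>R (\<integral>g. exp (s g * complex_of_real \<bar>\<zeta>\<bar>) \<partial>std_normal_vec) \<partial>lborel)"
  proof (rule integral_density)
    show "(\<lambda>\<zeta>. \<integral>g. exp (s g * complex_of_real \<bar>\<zeta>\<bar>) \<partial>std_normal_vec) \<in> borel_measurable lborel"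
      by (rule std_normal_vec.borel_measurable_lebesgue_integral) simp
  qed (simp_all add: chi2_density_nonneg)
  finally show ?thesis unfolding s_def .
qed

section \<open>The characteristic function of the product\<close>

lemma matrix_inv_positive_definite:
  fixes W :: "real^'n^'n"
  assumes "\<And>x. x \<noteq> 0 \<Longrightarrow> 0 < x \<bullet> (W *v x)"
  shows "W ** matrix_inv W = mat 1"
proof -
  have "\<forall>x. W *v x = 0 \<longrightarrow> x = 0" using assms by (metis inner_zero_right less_irrefl)
  then obtain B where "B ** W = mat 1" using matrix_left_invertible_ker by blast
  then have "W ** B = mat 1" using matrix_left_right_inverse by blast
  then show ?thesis by (simp add: matrix_inv_eqI)
qed

theorem theorem2:
  fixes M :: "'s measure"
    and A :: "'s \<Rightarrow> real^'k^'k" and z :: "'s \<Rightarrow> real^'k"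
    and \<Sigma> :: "real^'k^'k" and \<mu> :: "real^'k" and u :: "real^'k"
    and R :: "real^'r^'k" and \<Lambda> :: "real^'r^'r"
    and n :: nat and \<kappa> :: real
  assumes "prob_space M"
    and "n > 0"
    and "\<kappa> > 0"
    and "psd \<Sigma>"
    and "rank \<Sigma> = CARD('r)"
    and "CARD('r) < CARD('k)"
    and "\<forall>i j. i \<noteq> j \<longrightarrow> \<Lambda> $ i $ j = 0"
    and "\<forall>i. \<Lambda> $ i $ i \<noteq> 0"
    and "transpose R ** R = mat 1"
    and "\<Sigma> = R ** \<Lambda> ** transpose R"
    and "A \<in> borel_measurable M" and "z \<in> borel_measurable M"
    and "distr M borel A = wishart n \<Sigma>"
    and "distr M borel z = mvnormal \<mu> (\<kappa> *\<^sub>R \<Sigma>)"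
    and "distr M (borel \<Otimes>\<^sub>M borel) (\<lambda>\<omega>. (A \<omega>, z \<omega>))
         = distr M borel A \<Otimes>\<^sub>M distr M borel z"
  shows
    "(let \<Omega> = (\<lambda>\<zeta>::real. (1 / \<kappa>) *\<^sub>R matrix_inv \<Lambda>
              + \<zeta> *\<^sub>R ((u \<bullet> (\<Sigma> *v u)) *\<^sub>R \<Lambda>
                        - \<Lambda> ** transpose R ** outer_prod u u ** R ** \<Lambda>));
          \<nu> = (\<lambda>\<zeta>. (1 / \<kappa>) *\<^sub>R (matrix_inv (\<Omega> \<zeta>) *v (matrix_inv \<Lambda> *v (transpose R *v \<mu>))))
      in integral\<^sup>L M (\<lambda>\<omega>. cis (u \<bullet> (A \<omega> *v z \<omega>)))
       = complex_of_real
           (exp (- (1 / \<kappa>) / 2 * (\<mu> \<bullet> (R ** matrix_inv \<Lambda> ** transpose R *v \<mu>)))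
            / (\<kappa> powr (real CARD('r) / 2) * det \<Lambda> powr (1 / 2)))
         * (LINT \<zeta>:{0<..}|lborel.
              complex_of_real (det (\<Omega> \<zeta>) powr (- 1 / 2) * chi2_density n \<zeta>)
              * exp (Complex
                  (- (\<zeta>\<^sup>2 / 2) * (u \<bullet> (R ** \<Lambda> ** matrix_inv (\<Omega> \<zeta>) ** \<Lambda> ** transpose R *v u))
                   + 1 / 2 * (\<nu> \<zeta> \<bullet> (\<Omega> \<zeta> *v \<nu> \<zeta>)))
                  (\<zeta> * (\<nu> \<zeta> \<bullet> (\<Lambda> ** transpose R *v u))))))"
proof -
  note [simp del] = transpose_matrix_vector
  note n = \<open>n > 0\<close> and \<kappa> = \<open>\<kappa> > 0\<close>
  have RR: "transpose R ** R = mat 1" by fact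
  have RRv: "transpose R *v (R *v x) = x" for x by (simp add: matrix_vector_mul_assoc RR)
  have \<Sigma>: "\<Sigma> = R ** \<Lambda> ** transpose R" by fact
  define \<beta> where "\<beta> i = \<Lambda> $ i $ i" for i
  have \<Lambda>: "\<Lambda> = diag_matrix \<beta>"
    using assms(7) by (auto simp: vec_eq_iff diag_matrix_def \<beta>_def)
  have \<Sigma>v: "x \<bullet> (\<Sigma> *v y) = (transpose R *v x) \<bullet> (\<Lambda> *v (transpose R *v y))" for x y
  proof -
    have "\<Sigma> *v y = R *v (\<Lambda> *v (transpose R *v y))" by (simp add: \<Sigma> matrix_vector_mul_assoc matrix_mul_assoc)
    then show ?thesis by (simp only: adjoint_matrix_vector[of x R])
  qed
  \<comment> \<open>The form of \<Sigma> at the i-th column of \<open>R\<close> equals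
    \<open>\<beta> i\<close>, so it is nonnegative; the diagonal of \<Lambda> has no zeros.\<close>
  have \<beta>: "\<beta> i > 0" for i
  proof -
    have "0 \<le> (R *v axis i 1) \<bullet> (\<Sigma> *v (R *v axis i 1))" using \<open>psd \<Sigma>\<close> by (simp add: psd_def)
    also have "\<dots> = \<beta> i" unfolding \<Sigma>v RRv \<Lambda> by (simp add: inner_axis')
    finally show ?thesis using assms(8) by (simp add: \<beta>_def less_le)
  qed
  have \<beta>0: "\<beta> i \<noteq> 0" for i using \<beta>[of i] by simp
  \<comment> \<open>This root of \<Lambda> has two uses: it builds the root \<open>S\<close> of
    \<Sigma>, and it turns the inner product \<open>x . \<Lambda> y\<close> into the Euclidean one
    for Cauchy-Schwarz.\<close>
  define L where "L = diag_matrix (\<lambda>i. sqrt (\<beta> i))"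
  have LL: "L ** L = \<Lambda>" using \<beta> by (simp add: L_def \<Lambda> diag_matrix_mult less_imp_le)
  have LLv: "(L *v x) \<bullet> (L *v y) = x \<bullet> (\<Lambda> *v y)" for x y
  proof -
    have *: "sqrt (\<beta> i) * a * (sqrt (\<beta> i) * b) = a * (\<beta> i * b)" for a b i
      using \<beta>[of i] by (simp add: mult.left_commute mult.assoc[symmetric])
    show ?thesis by (simp add: L_def \<Lambda> inner_vec_def *)
  qed
  define S where "S = R ** L ** transpose R"
  have Sv: "S *v x = R *v (L *v (transpose R *v x))" for x
    by (simp add: S_def matrix_vector_mul_assoc matrix_mul_assoc)
  \<comment> \<open>The scalar lets one proof cover the roots of both \<Sigma>
    (\<open>c = 1\<close>) and \<open>\<kappa> *\<^sub>R \<Sigma>\<close>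
    (\<open>c = sqrt \<kappa>\<close>).\<close>
  have psdS: "psd (c *\<^sub>R S)" if "c \<ge> 0" for c
    unfolding psd_def
  proof
    show "transpose (c *\<^sub>R S) = c *\<^sub>R S"
      by (simp add: S_def transpose_scalar scalar_matrix_assoc[symmetric] matrix_transpose_mul L_def transpose_diag_matrix matrix_mul_assoc)
    have "x \<bullet> (S *v x) = (transpose R *v x) \<bullet> (L *v (transpose R *v x))" for x
      unfolding Sv adjoint_matrix_vector[of x R] ..
    moreover have "y \<bullet> (L *v y) \<ge> 0" for y
    proof -
      have "0 \<le> y $ i * (sqrt (\<beta> i) * y $ i)" for i
        using mult_nonneg_nonneg[of "sqrt (\<beta> i)" "y $ i * y $ i"] less_imp_le[OF \<beta>[of i]]
        by (simp add: mult.left_commute)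
      then show ?thesis unfolding L_def inner_vec_def by (intro sum_nonneg) simp
    qed
    ultimately show "\<forall>x. 0 \<le> x \<bullet> ((c *\<^sub>R S) *v x)"
      using that by (simp add: scaleR_matrix_vector_assoc[symmetric])
  qed
  have SS: "S ** S = \<Sigma>"
    by (simp add: matrix_eq matrix_vector_mul_assoc[symmetric] Sv RRv \<Sigma> LL[symmetric])
  have S'S': "(sqrt \<kappa> *\<^sub>R S) ** (sqrt \<kappa> *\<^sub>R S) = \<kappa> *\<^sub>R \<Sigma>"
    using \<kappa> by (simp add: matrix_eq matrix_vector_mul_assoc[symmetric] scaleR_matrix_vector_assoc[symmetric]
        matrix_vector_mult_scaleR SS[symmetric])
  define T where "T = R ** diag_matrix (\<lambda>i. sqrt (\<kappa> * \<beta> i))"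
  have TT: "T ** transpose T = \<kappa> *\<^sub>R \<Sigma>"
  proof -
    have "diag_matrix (\<lambda>i. sqrt (\<kappa> * \<beta> i)) *v (diag_matrix (\<lambda>i. sqrt (\<kappa> * \<beta> i)) *v x) = \<kappa> *\<^sub>R (\<Lambda> *v x)" for x
      using \<kappa> \<beta> by (simp add: vec_eq_iff \<Lambda> mult.assoc[symmetric] less_imp_le)
    then show ?thesis
      by (simp add: matrix_eq T_def \<Sigma> matrix_transpose_mul transpose_diag_matrix
          matrix_vector_mul_assoc[symmetric] scaleR_matrix_vector_assoc[symmetric] matrix_vector_mult_scaleR)
  qed
  define p where "p = transpose R *v u"
  define t where "t = \<Lambda> *v p"
  define m where "m = transpose R *v \<mu>"
  define \<alpha> where "\<alpha> = u \<bullet> (\<Sigma> *v u)"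
  define D where "D = diag_matrix (\<lambda>i. 1 / (\<kappa> * \<beta> i))"
  define \<Omega> where "\<Omega> \<zeta> = (1 / \<kappa>) *\<^sub>R matrix_inv \<Lambda>
      + \<zeta> *\<^sub>R ((u \<bullet> (\<Sigma> *v u)) *\<^sub>R \<Lambda> - \<Lambda> ** transpose R ** outer_prod u u ** R ** \<Lambda>)" for \<zeta> :: real
  define \<nu> where "\<nu> \<zeta> = (1 / \<kappa>) *\<^sub>R (matrix_inv (\<Omega> \<zeta>) *v (matrix_inv \<Lambda> *v (transpose R *v \<mu>)))" for \<zeta>
  have \<Lambda>i: "matrix_inv \<Lambda> = diag_matrix (\<lambda>i. 1 / \<beta> i)"
    by (rule matrix_inv_eqI) (simp add: \<Lambda> diag_matrix_mult \<beta>0 diag_matrix_one)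
  have \<Lambda>sym: "x \<bullet> (\<Lambda> *v y) = (\<Lambda> *v x) \<bullet> y" for x y
    by (simp add: adjoint_matrix_vector[of x] \<Lambda> transpose_diag_matrix)
  have tp: "t \<bullet> x = p \<bullet> (\<Lambda> *v x)" for x by (simp add: t_def \<Lambda>sym)
  have \<alpha>: "\<alpha> = p \<bullet> (\<Lambda> *v p)" by (simp add: \<alpha>_def \<Sigma>v p_def)
  have \<alpha>0: "\<alpha> \<ge> 0" unfolding \<alpha> LLv[symmetric] by simp
  have D: "D = (1 / \<kappa>) *\<^sub>R matrix_inv \<Lambda>"
    by (simp add: D_def \<Lambda>i vec_eq_iff diag_matrix_nth)
  have outer: "\<Lambda> ** transpose R ** outer_prod u u ** R ** \<Lambda> = outer_prod t t"
  proof -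
    have "u \<bullet> (R *v (\<Lambda> *v x)) = t \<bullet> x" for x
      by (simp add: adjoint_matrix_vector[of u R] p_def[symmetric] tp)
    then show ?thesis
      by (simp add: matrix_eq matrix_vector_mul_assoc[symmetric] outer_prod_mult_vec matrix_vector_mult_scaleR
          t_def p_def)
  qed
  have \<Omega>: "\<Omega> \<zeta> = diag_matrix (\<lambda>i. 1 / (\<kappa> * \<beta> i) + \<zeta> * \<alpha> * \<beta> i) - \<zeta> *\<^sub>R outer_prod t t" for \<zeta>
    unfolding \<Omega>_def outer \<Lambda>i \<alpha>_def[symmetric]
    by (simp add: \<Lambda> vec_eq_iff diag_matrix_nth algebra_simps)
  \<comment> \<open>\<open>D\<close> is positive definite, and the bracket is a Gram determinant of
    \<open>L p\<close> and \<open>L x\<close>, hence nonnegative.\<close>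
  have pd: "0 < x \<bullet> (\<Omega> \<zeta> *v x)" if "\<zeta> \<ge> 0" "x \<noteq> 0" for \<zeta> x
  proof -
    have "\<Omega> \<zeta> *v x = D *v x + \<zeta> *\<^sub>R (\<alpha> *\<^sub>R (\<Lambda> *v x) - (t \<bullet> x) *\<^sub>R t)"
      by (simp add: \<Omega>_def outer D \<alpha>_def[symmetric] matrix_vector_mult_add_rdistrib matrix_vector_mult_diff_rdistrib
          scaleR_matrix_vector_assoc[symmetric] outer_prod_mult_vec)
    then have "x \<bullet> (\<Omega> \<zeta> *v x) = x \<bullet> (D *v x) + \<zeta> * (\<alpha> * (x \<bullet> (\<Lambda> *v x)) - (t \<bullet> x)\<^sup>2)"
      by (simp add: inner_add_right inner_diff_right power2_eq_square inner_commute)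
    moreover have "\<alpha> * (x \<bullet> (\<Lambda> *v x)) - (t \<bullet> x)\<^sup>2 \<ge> 0"
      using Cauchy_Schwarz_ineq[of "L *v p" "L *v x"] by (simp add: LLv \<alpha> tp)
    moreover have "x \<bullet> (D *v x) > 0"
    proof -
      obtain i where "x $ i \<noteq> 0" using \<open>x \<noteq> 0\<close> by (auto simp: vec_eq_iff)
      moreover have "1 / (\<kappa> * \<beta> i) > 0" for i using \<kappa> \<beta> by simp
      ultimately show ?thesis
        using \<kappa> \<beta> by (auto simp: inner_vec_def D_def less_imp_le zero_less_mult_iff
          intro!: sum_pos2[of _ i] divide_pos_pos divide_nonneg_pos not_square_less_zero)
    qed
    ultimately show ?thesis using that by (simp add: add_pos_nonneg)
  qed
  let ?Y = "\<lambda>y. m + diag_matrix (\<lambda>i. sqrt (\<kappa> * \<beta> i)) *v y"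
  let ?z = "\<lambda>g. \<mu> + T *v g"
  \<comment> \<open>Only \<open>transpose R *v z\<close> enters the exponent, and it is an
    r-dimensional normal vector with a diagonal factor.\<close>
  have Rz: "transpose R *v ?z g = ?Y g" for g
    by (simp add: matrix_vector_right_distrib T_def matrix_vector_mul_assoc[symmetric] RRv m_def)
  have zz: "?z g \<bullet> (\<Sigma> *v ?z g) = ?Y g \<bullet> (diag_matrix \<beta> *v ?Y g)" "u \<bullet> (\<Sigma> *v ?z g) = t \<bullet> ?Y g" for g
    unfolding \<Sigma>v Rz p_def[symmetric] tp \<Lambda> by simp_all
  define K where "K = exp (- (1 / \<kappa>) / 2 * (\<mu> \<bullet> (R ** matrix_inv \<Lambda> ** transpose R *v \<mu>)))
            / (\<kappa> powr (real CARD('r) / 2) * det \<Lambda> powr (1 / 2))"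
  have K: "exp (- (m \<bullet> (D *v m)) / 2) / sqrt (\<Prod>i\<in>UNIV. \<kappa> * \<beta> i) = K"
  proof -
    have "\<mu> \<bullet> (R ** matrix_inv \<Lambda> ** transpose R *v \<mu>) = m \<bullet> (matrix_inv \<Lambda> *v m)"
      by (simp add: matrix_vector_mul_assoc[symmetric] adjoint_matrix_vector[of \<mu> R] m_def)
    moreover have "m \<bullet> (D *v m) = (1 / \<kappa>) * (m \<bullet> (matrix_inv \<Lambda> *v m))"
      unfolding D by (simp add: scaleR_matrix_vector_assoc[symmetric])
    moreover have "sqrt (\<Prod>i\<in>UNIV. \<kappa> * \<beta> i) = \<kappa> powr (real CARD('r) / 2) * det \<Lambda> powr (1 / 2)"
    proof -
      have "det \<Lambda> > 0" unfolding \<Lambda> det_diag_matrix using \<beta> by (simp add: prod_pos)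
      moreover have "(\<Prod>i\<in>(UNIV::'r set). \<kappa> * \<beta> i) = \<kappa> ^ CARD('r) * det \<Lambda>"
        unfolding \<Lambda> det_diag_matrix by (simp add: prod.distrib)
      moreover have "sqrt (\<kappa> ^ CARD('r)) = \<kappa> powr (real CARD('r) / 2)"
        using \<kappa> by (simp add: powr_half_sqrt[symmetric] powr_realpow[symmetric] powr_powr)
      ultimately show ?thesis using \<kappa> by (simp add: real_sqrt_mult powr_half_sqrt)
    qed
    ultimately show ?thesis by (simp add: K_def)
  qed
  have inner: "(\<integral>g. exp (Complex (- ((u \<bullet> (\<Sigma> *v u)) * (?z g \<bullet> (\<Sigma> *v ?z g)) - (u \<bullet> (\<Sigma> *v ?z g))\<^sup>2) / 2)
          (u \<bullet> (\<Sigma> *v ?z g)) * complex_of_real \<bar>\<zeta>\<bar>) \<partial>std_normal_vec)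
      = K * (det (\<Omega> \<zeta>) powr (- 1 / 2) * exp (Complex
                  (- (\<zeta>\<^sup>2 / 2) * (u \<bullet> (R ** \<Lambda> ** matrix_inv (\<Omega> \<zeta>) ** \<Lambda> ** transpose R *v u))
                   + 1 / 2 * (\<nu> \<zeta> \<bullet> (\<Omega> \<zeta> *v \<nu> \<zeta>)))
                  (\<zeta> * (\<nu> \<zeta> \<bullet> (\<Lambda> ** transpose R *v u)))))" if "\<zeta> > 0" for \<zeta>
  proof -
    define c where "c = D *v m"
    have nonneg: "\<zeta> \<ge> 0" using that by simp
    have \<nu>c: "\<nu> \<zeta> = matrix_inv (\<Omega> \<zeta>) *v c"
      by (simp add: \<nu>_def c_def D m_def scaleR_matrix_vector_assoc[symmetric] matrix_vector_mult_scaleR)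
    have inv: "\<Omega> \<zeta> ** matrix_inv (\<Omega> \<zeta>) = mat 1"
      by (rule matrix_inv_positive_definite) (rule pd[OF nonneg])
    \<comment> \<open>\<open>\<nu> \<zeta>\<close> is the real part of the critical point of the
      quadratic exponent, so its form under \<Omega> is the form of \<open>c\<close> under the
      inverse.\<close>
    have "\<Omega> \<zeta> *v \<nu> \<zeta> = c"
      unfolding \<nu>c matrix_vector_mul_assoc inv by simp
    then have q1: "\<nu> \<zeta> \<bullet> (\<Omega> \<zeta> *v \<nu> \<zeta>) = c \<bullet> (matrix_inv (\<Omega> \<zeta>) *v c)"
      by (simp add: \<nu>c inner_commute)
    have q2: "u \<bullet> (R ** \<Lambda> ** matrix_inv (\<Omega> \<zeta>) ** \<Lambda> ** transpose R *v u) = t \<bullet> (matrix_inv (\<Omega> \<zeta>) *v t)"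
      by (simp add: matrix_vector_mul_assoc[symmetric] adjoint_matrix_vector[of u R] p_def[symmetric] \<Lambda>sym[of p] t_def)
    have q3: "\<nu> \<zeta> \<bullet> (\<Lambda> ** transpose R *v u) = t \<bullet> (matrix_inv (\<Omega> \<zeta>) *v c)"
      by (simp add: \<nu>c matrix_vector_mul_assoc[symmetric] p_def[symmetric] t_def inner_commute)
    have "(\<integral>g. exp (Complex (- ((u \<bullet> (\<Sigma> *v u)) * (?z g \<bullet> (\<Sigma> *v ?z g)) - (u \<bullet> (\<Sigma> *v ?z g))\<^sup>2) / 2)
          (u \<bullet> (\<Sigma> *v ?z g)) * complex_of_real \<bar>\<zeta>\<bar>) \<partial>std_normal_vec)
      = (\<integral>y. exp (Complex (- (\<zeta> / 2) * (\<alpha> * (?Y y \<bullet> (diag_matrix \<beta> *v ?Y y)) - (t \<bullet> ?Y y)\<^sup>2))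
            (\<zeta> * (t \<bullet> ?Y y))) \<partial>std_normal_vec)"
      unfolding zz \<alpha>_def[symmetric] using that
      by (intro Bochner_Integration.integral_cong refl arg_cong[where f=exp]) (simp add: complex_eq_iff mult.commute, simp add: right_diff_distrib)
    also have "\<dots> = complex_of_real (K * det (\<Omega> \<zeta>) powr (- 1 / 2)) *
      exp (Complex ((c \<bullet> (matrix_inv (\<Omega> \<zeta>) *v c) - \<zeta>\<^sup>2 * (t \<bullet> (matrix_inv (\<Omega> \<zeta>) *v t))) / 2)
            (\<zeta> * (t \<bullet> (matrix_inv (\<Omega> \<zeta>) *v c))))"
      unfolding K[symmetric] \<Omega> D_def c_def
      by (rule gaussian_quadratic_expectation[OF \<beta> \<kappa> nonneg \<alpha>0], fold \<Omega>) (rule pd[OF nonneg])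
    finally show ?thesis
      unfolding q1 q2 q3 by (simp add: diff_divide_distrib)
  qed
  have mA [measurable]: "A \<in> borel_measurable M" and mz [measurable]: "z \<in> borel_measurable M" by fact+
  have "integral\<^sup>L M (\<lambda>\<omega>. cis (u \<bullet> (A \<omega> *v z \<omega>)))
      = (\<integral>p. cis (u \<bullet> (fst p *v snd p)) \<partial>distr M (borel \<Otimes>\<^sub>M borel) (\<lambda>\<omega>. (A \<omega>, z \<omega>)))"
    by (subst integral_distr) simp_all
  also have "\<dots> = (\<integral>p. cis (u \<bullet> (fst p *v snd p)) \<partial>(wishart n \<Sigma> \<Otimes>\<^sub>M mvnormal \<mu> (\<kappa> *\<^sub>R \<Sigma>)))"
    using assms(13-15) by simp
  also have "\<dots> = (\<integral>\<zeta>. chi2_density n \<zeta> *\<^sub>R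
        (\<integral>g. exp (Complex (- ((u \<bullet> (\<Sigma> *v u)) * (?z g \<bullet> (\<Sigma> *v ?z g)) - (u \<bullet> (\<Sigma> *v ?z g))\<^sup>2) / 2)
          (u \<bullet> (\<Sigma> *v ?z g)) * complex_of_real \<bar>\<zeta>\<bar>) \<partial>std_normal_vec) \<partial>lborel)"
    using psdS[of 1] psdS[of "sqrt \<kappa>"] \<kappa>
    by (intro integral_wishart_mvnormal_cis[OF n _ SS _ S'S' TT]) simp_all
  also have "\<dots> = (\<integral>\<zeta>. K * (indicator {0<..} \<zeta> *\<^sub>R
        (complex_of_real (det (\<Omega> \<zeta>) powr (- 1 / 2) * chi2_density n \<zeta>)
              * exp (Complex
                  (- (\<zeta>\<^sup>2 / 2) * (u \<bullet> (R ** \<Lambda> ** matrix_inv (\<Omega> \<zeta>) ** \<Lambda> ** transpose R *v u))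
                   + 1 / 2 * (\<nu> \<zeta> \<bullet> (\<Omega> \<zeta> *v \<nu> \<zeta>)))
                  (\<zeta> * (\<nu> \<zeta> \<bullet> (\<Lambda> ** transpose R *v u)))))) \<partial>lborel)"
  \<comment> \<open>The density vanishes for nonpositive \<zeta>, so the Gaussian evaluation is
    required only on the half-line named by the indicator.\<close>
  proof (rule Bochner_Integration.integral_cong[OF refl])
    fix \<zeta> :: real
    show "chi2_density n \<zeta> *\<^sub>R
        (\<integral>g. exp (Complex (- ((u \<bullet> (\<Sigma> *v u)) * (?z g \<bullet> (\<Sigma> *v ?z g)) - (u \<bullet> (\<Sigma> *v ?z g))\<^sup>2) / 2)
          (u \<bullet> (\<Sigma> *v ?z g)) * complex_of_real \<bar>\<zeta>\<bar>) \<partial>std_normal_vec)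
      = K * (indicator {0<..} \<zeta> *\<^sub>R
        (complex_of_real (det (\<Omega> \<zeta>) powr (- 1 / 2) * chi2_density n \<zeta>)
              * exp (Complex
                  (- (\<zeta>\<^sup>2 / 2) * (u \<bullet> (R ** \<Lambda> ** matrix_inv (\<Omega> \<zeta>) ** \<Lambda> ** transpose R *v u))
                   + 1 / 2 * (\<nu> \<zeta> \<bullet> (\<Omega> \<zeta> *v \<nu> \<zeta>)))
                  (\<zeta> * (\<nu> \<zeta> \<bullet> (\<Lambda> ** transpose R *v u))))))"
    proof (cases "\<zeta> > 0")
      case True
      then show ?thesis unfolding inner[OF True] by (simp add: scaleR_conv_of_real)
    next
      case False
      then have "chi2_density n \<zeta> = 0" by (simp add: chi2_density_def)
      then show ?thesis by simp
    qed
  qed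
  finally show ?thesis
    unfolding Let_def \<nu>_def[symmetric] \<Omega>_def[symmetric] \<nu>_def[symmetric] K_def[symmetric] set_lebesgue_integral_def
    by (simp only: integral_mult_right_zero)
qed

end
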